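(* Let $V$, $V_1$, $W$ and $W_1$ be operator spaces. Given complete contractions $\varphi: V\to V_1$ and $\phi: W\to W_1$, the corresponding map $\varphi \otimes \phi: V\otimes W\to V_1\otimes W_1$ extends to a complete contraction $\varphi \otimes^s \phi: V\otimes^s W\to V_1\otimes^s W_1$.
   Context: An operator space is a closed subspace of $B(H)$ with the inherited matrix norms. For $x=[x_{ij}]\in M_n(V)$ and $y=[y_{ij}]\in M_n(W)$ put $x\circ y=[x_{ij}\otimes y_{ij}]\in M_n(V\otimes W)$. For $u\in M_p(V\otimes W)$, $\|u\|_s=\inf\{\|\alpha\|\|x\|\|y\|\|\beta\|\}$, the infimum over all decompositions $u=\alpha(x\circ y)\beta$ with $n\in\mathbb{N}$, $x\in M_n(V)$, $y\in M_n(W)$, $\alpha\in M_{p,n}(\mathbb{C})$, $\beta\in M_{n,p}(\mathbb{C})$. $V\otimes^sW$ is the completion of $V\otimes W$ for these matrix norms (an operator space). A complete contraction is a linear map with completely bounded norm at most $1$. *)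

theory Defs
  imports "HOL-Analysis.Analysis" "HOL-Library.Poly_Mapping"
begin

section \<open>Complex Hilbert spaces\<close>

text \<open>
  A complex Hilbert space is presented over the library class of complete real inner product spaces:
  the real inner product is the real part of the complex one, so that the library norm satisfies
  \<open>\<parallel>x\<parallel>\<^sup>2 = Re \<langle>x, x\<rangle> = \<langle>x, x\<rangle>\<close>.
\<close>

class chilbert_space = real_inner + complete_space +
  fixes scaleC :: "complex \<Rightarrow> 'a \<Rightarrow> 'a" (infixr \<open>*\<^sub>C\<close> 75)
    and cinner :: "'a \<Rightarrow> 'a \<Rightarrow> complex"
  assumes scaleC_add_right: "c *\<^sub>C (x + y) = c *\<^sub>C x + c *\<^sub>C y"
    and scaleC_add_left: "(c + d) *\<^sub>C x = c *\<^sub>C x + d *\<^sub>C x"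
    and scaleC_scaleC: "c *\<^sub>C (d *\<^sub>C x) = (c * d) *\<^sub>C x"
    and scaleR_scaleC: "r *\<^sub>R x = complex_of_real r *\<^sub>C x"
    and cinner_commute: "cinner x y = cnj (cinner y x)"
    and cinner_add_left: "cinner (x + y) z = cinner x z + cinner y z"
    and cinner_scaleC_left: "cinner (c *\<^sub>C x) y = c * cinner x y"
    and inner_eq_Re_cinner: "inner x y = Re (cinner x y)"

lemma norm_scaleC: "norm (c *\<^sub>C x) = cmod c * norm (x :: 'a::chilbert_space)"
proof -
  have s: "cinner x (c *\<^sub>C x) = cnj c * cinner x x" for x :: 'a
    by (metis cinner_commute cinner_scaleC_left complex_cnj_mult)
  have "cinner (c *\<^sub>C x) (c *\<^sub>C x) = complex_of_real ((cmod c)\<^sup>2) * cinner x x"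
    unfolding cinner_scaleC_left s complex_norm_square by (simp add: mult.assoc)
  then have "inner (c *\<^sub>C x) (c *\<^sub>C x) = (cmod c)\<^sup>2 * inner x x"
    by (simp only: inner_eq_Re_cinner times_complex.simps Re_complex_of_real Im_complex_of_real
        mult_zero_left diff_zero)
  then show ?thesis
    by (simp add: norm_eq_sqrt_inner real_sqrt_mult)
qed

lemma bounded_linear_scaleC: "bounded_linear ((*\<^sub>C) c :: 'a::chilbert_space \<Rightarrow> 'a)"
proof (rule bounded_linear_intro[where K = "cmod c"])
  fix r and x :: 'a
  show "c *\<^sub>C (r *\<^sub>R x) = r *\<^sub>R (c *\<^sub>C x)"
    by (simp add: scaleR_scaleC scaleC_scaleC mult.commute)
qed (simp_all add: scaleC_add_right norm_scaleC mult.commute)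

section \<open>Matrix-normed spaces and completely bounded maps\<close>

text \<open>
  A square matrix over a space is a function \<open>nat \<Rightarrow> nat \<Rightarrow> 'a\<close> of which only the entries with
  indices below the stated size matter; \<open>mnorm A n\<close> is the norm on \<open>M\<^sub>n(A)\<close>.
  The records only collect data; no axioms are built into them.
\<close>

record 'a cspace =
  carrier :: "'a set"
  mzero :: 'a
  madd :: "'a \<Rightarrow> 'a \<Rightarrow> 'a"
  mscale :: "complex \<Rightarrow> 'a \<Rightarrow> 'a"

record 'a mspace = "'a cspace" +
  mnorm :: "nat \<Rightarrow> (nat \<Rightarrow> nat \<Rightarrow> 'a) \<Rightarrow> real"

definition mats :: "nat \<Rightarrow> 'a mspace \<Rightarrow> (nat \<Rightarrow> nat \<Rightarrow> 'a) set" where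
  "mats n A = {x. \<forall>i<n. \<forall>j<n. x i j \<in> carrier A}"

definition clinear_between :: "'a mspace \<Rightarrow> 'b mspace \<Rightarrow> ('a \<Rightarrow> 'b) \<Rightarrow> bool" where
  "clinear_between A B f \<longleftrightarrow>
     f ` carrier A \<subseteq> carrier B \<and>
     (\<forall>x\<in>carrier A. \<forall>y\<in>carrier A. f (madd A x y) = madd B (f x) (f y)) \<and>
     (\<forall>c. \<forall>x\<in>carrier A. f (mscale A c x) = mscale B c (f x))"

text \<open>The supremum over \<open>n\<close> of the norms of the amplifications \<open>M\<^sub>n(A) \<rightarrow> M\<^sub>n(B)\<close>, possibly infinite.\<close>

definition cb_norm :: "'a mspace \<Rightarrow> 'b mspace \<Rightarrow> ('a \<Rightarrow> 'b) \<Rightarrow> ennreal" where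
  "cb_norm A B f =
     (SUP n\<in>{1..}. SUP x\<in>{x \<in> mats n A. mnorm A n x \<le> 1}. ennreal (mnorm B n (\<lambda>i j. f (x i j))))"

definition complete_contraction :: "'a mspace \<Rightarrow> 'b mspace \<Rightarrow> ('a \<Rightarrow> 'b) \<Rightarrow> bool" where
  "complete_contraction A B f \<longleftrightarrow> clinear_between A B f \<and> cb_norm A B f \<le> 1"

section \<open>Operator spaces\<close>

definition scaleC_op :: "complex \<Rightarrow> ('h::chilbert_space \<Rightarrow>\<^sub>L 'h) \<Rightarrow> ('h \<Rightarrow>\<^sub>L 'h)" where
  "scaleC_op c T = Blinfun (\<lambda>x. c *\<^sub>C blinfun_apply T x)"

lemma scaleC_op_apply [simp]: "blinfun_apply (scaleC_op c T) x = c *\<^sub>C blinfun_apply T x"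
  unfolding scaleC_op_def
  by (subst bounded_linear_Blinfun_apply)
    (intro bounded_linear_compose[OF bounded_linear_scaleC] blinfun.bounded_linear_right refl)+

text \<open>\<open>B(H)\<close>: the elements of the library type of bounded real-linear maps that are complex-linear.\<close>

definition BH :: "('h::chilbert_space \<Rightarrow>\<^sub>L 'h) set" where
  "BH = {T. \<forall>c x. blinfun_apply T (c *\<^sub>C x) = c *\<^sub>C blinfun_apply T x}"

definition operator_space :: "('h::chilbert_space \<Rightarrow>\<^sub>L 'h) set \<Rightarrow> bool" where
  "operator_space V \<longleftrightarrow>
     V \<subseteq> BH \<and> closed V \<and> 0 \<in> V \<and> (\<forall>x\<in>V. \<forall>y\<in>V. x + y \<in> V) \<and> (\<forall>c. \<forall>x\<in>V. scaleC_op c x \<in> V)"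

text \<open>The norm of \<open>[x\<^sub>i\<^sub>j] \<in> M\<^sub>n(B(H)) = B(H\<^sup>n)\<close>, where \<open>H\<^sup>n\<close> carries the Hilbert sum norm.\<close>

definition op_mnorm :: "nat \<Rightarrow> (nat \<Rightarrow> nat \<Rightarrow> ('h::chilbert_space \<Rightarrow>\<^sub>L 'h)) \<Rightarrow> real" where
  "op_mnorm n x =
     (SUP \<xi>\<in>{\<xi>. L2_set (\<lambda>j. norm (\<xi> j)) {..<n} \<le> 1}.
        L2_set (\<lambda>i. norm (\<Sum>j<n. blinfun_apply (x i j) (\<xi> j))) {..<n})"

definition op_mspace :: "('h::chilbert_space \<Rightarrow>\<^sub>L 'h) set \<Rightarrow> ('h \<Rightarrow>\<^sub>L 'h) mspace" where
  "op_mspace V =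
     \<lparr>carrier = V, mzero = 0, madd = (+), mscale = scaleC_op, mnorm = op_mnorm\<rparr>"

text \<open>The operator norm of \<open>\<alpha> \<in> M\<^sub>p\<^sub>,\<^sub>n(\<complex>)\<close> as a map from \<open>\<complex>\<^sup>n\<close> to \<open>\<complex>\<^sup>p\<close>.\<close>

definition cmat_norm :: "nat \<Rightarrow> nat \<Rightarrow> (nat \<Rightarrow> nat \<Rightarrow> complex) \<Rightarrow> real" where
  "cmat_norm p n \<alpha> =
     (SUP z\<in>{z. L2_set (\<lambda>j. cmod (z j)) {..<n} \<le> 1}. L2_set (\<lambda>i. cmod (\<Sum>j<n. \<alpha> i j * z j)) {..<p})"

section \<open>The algebraic tensor product\<close>

text \<open>
  The quotient of the free complex vector space on the product of the two carriers by the span of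
  the bilinearity relations. Its elements are the equivalence classes.
\<close>

definition free_scale :: "complex \<Rightarrow> ('x \<Rightarrow>\<^sub>0 complex) \<Rightarrow> ('x \<Rightarrow>\<^sub>0 complex)" where
  "free_scale c f = Poly_Mapping.map ((*) c) f"

lemma lookup_free_scale [simp]:
  "Poly_Mapping.lookup (free_scale c f) k = c * Poly_Mapping.lookup f k"
  by (simp add: free_scale_def Poly_Mapping.map.rep_eq when_def)

global_interpretation free: vector_space free_scale
  by standard (auto intro!: poly_mapping_eqI simp: lookup_add algebra_simps)

definition free_pairs :: "'a mspace \<Rightarrow> 'b mspace \<Rightarrow> ('a \<times> 'b \<Rightarrow>\<^sub>0 complex) set" where
  "free_pairs A B = {f. Poly_Mapping.keys f \<subseteq> carrier A \<times> carrier B}"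

abbreviation fgen :: "'a \<Rightarrow> 'b \<Rightarrow> ('a \<times> 'b \<Rightarrow>\<^sub>0 complex)" where
  "fgen v w \<equiv> Poly_Mapping.single (v, w) 1"

definition bilin_relators :: "'a mspace \<Rightarrow> 'b mspace \<Rightarrow> ('a \<times> 'b \<Rightarrow>\<^sub>0 complex) set" where
  "bilin_relators A B =
     {fgen (madd A v v') w - fgen v w - fgen v' w |v v' w.
        v \<in> carrier A \<and> v' \<in> carrier A \<and> w \<in> carrier B} \<union>
     {fgen v (madd B w w') - fgen v w - fgen v w' |v w w'.
        v \<in> carrier A \<and> w \<in> carrier B \<and> w' \<in> carrier B} \<union>
     {fgen (mscale A c v) w - free_scale c (fgen v w) |c v w. v \<in> carrier A \<and> w \<in> carrier B} \<union>
     {fgen v (mscale B c w) - free_scale c (fgen v w) |c v w. v \<in> carrier A \<and> w \<in> carrier B}"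

definition tensor_rel ::
  "'a mspace \<Rightarrow> 'b mspace \<Rightarrow> (('a \<times> 'b \<Rightarrow>\<^sub>0 complex) \<times> ('a \<times> 'b \<Rightarrow>\<^sub>0 complex)) set" where
  "tensor_rel A B =
     {(f, g). f \<in> free_pairs A B \<and> g \<in> free_pairs A B \<and> f - g \<in> free.span (bilin_relators A B)}"

lemma equiv_tensor_rel: "equiv (free_pairs A B) (tensor_rel A B)"
proof (rule equivI)
  show "tensor_rel A B \<subseteq> free_pairs A B \<times> free_pairs A B"
    by (auto simp: tensor_rel_def)
  show "refl_on (free_pairs A B) (tensor_rel A B)"
    by (auto simp: refl_on_def tensor_rel_def free.span_zero)
  show "sym (tensor_rel A B)"
  proof (rule symI)
    fix f g assume *: "(f, g) \<in> tensor_rel A B"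
    then have "- (f - g) \<in> free.span (bilin_relators A B)"
      by (intro free.span_neg) (auto simp: tensor_rel_def)
    then show "(g, f) \<in> tensor_rel A B"
      using * by (simp add: tensor_rel_def)
  qed
  show "trans (tensor_rel A B)"
  proof (rule transI)
    fix f g h assume *: "(f, g) \<in> tensor_rel A B" "(g, h) \<in> tensor_rel A B"
    then have "(f - g) + (g - h) \<in> free.span (bilin_relators A B)"
      by (intro free.span_add) (auto simp: tensor_rel_def)
    then show "(f, h) \<in> tensor_rel A B"
      using * by (simp add: tensor_rel_def)
  qed
qed

type_synonym ('a, 'b) tensor = "('a \<times> 'b \<Rightarrow>\<^sub>0 complex) set"

definition elem_tensor :: "'a mspace \<Rightarrow> 'b mspace \<Rightarrow> 'a \<Rightarrow> 'b \<Rightarrow> ('a, 'b) tensor" where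
  "elem_tensor A B v w = tensor_rel A B `` {fgen v w}"

definition tensor_carrier :: "'a mspace \<Rightarrow> 'b mspace \<Rightarrow> ('a, 'b) tensor set" where
  "tensor_carrier A B = free_pairs A B // tensor_rel A B"

definition tensor_zero :: "'a mspace \<Rightarrow> 'b mspace \<Rightarrow> ('a, 'b) tensor" where
  "tensor_zero A B = tensor_rel A B `` {0}"

definition tensor_add ::
  "'a mspace \<Rightarrow> 'b mspace \<Rightarrow> ('a, 'b) tensor \<Rightarrow> ('a, 'b) tensor \<Rightarrow> ('a, 'b) tensor" where
  "tensor_add A B s t = (\<Union>f\<in>s. \<Union>g\<in>t. tensor_rel A B `` {f + g})"

definition tensor_scale ::
  "'a mspace \<Rightarrow> 'b mspace \<Rightarrow> complex \<Rightarrow> ('a, 'b) tensor \<Rightarrow> ('a, 'b) tensor" where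
  "tensor_scale A B c s = (\<Union>f\<in>s. tensor_rel A B `` {free_scale c f})"

definition tensor_vs :: "'a mspace \<Rightarrow> 'b mspace \<Rightarrow> ('a, 'b) tensor cspace" where
  "tensor_vs A B =
     \<lparr>carrier = tensor_carrier A B, mzero = tensor_zero A B, madd = tensor_add A B,
      mscale = tensor_scale A B\<rparr>"

text \<open>
  The map \<open>\<phi> \<otimes> \<psi>\<close>, induced by \<open>\<Sum>\<^sub>k c\<^sub>k (v\<^sub>k, w\<^sub>k) \<mapsto> \<Sum>\<^sub>k c\<^sub>k (\<phi> v\<^sub>k, \<psi> w\<^sub>k)\<close> on the free spaces.
\<close>

definition free_map ::
  "('a \<Rightarrow> 'c) \<Rightarrow> ('b \<Rightarrow> 'd) \<Rightarrow> ('a \<times> 'b \<Rightarrow>\<^sub>0 complex) \<Rightarrow> ('c \<times> 'd \<Rightarrow>\<^sub>0 complex)" where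
  "free_map \<phi> \<psi> f =
     (\<Sum>k\<in>Poly_Mapping.keys f.
        Poly_Mapping.single (\<phi> (fst k), \<psi> (snd k)) (Poly_Mapping.lookup f k))"

definition tensor_map ::
  "'c mspace \<Rightarrow> 'd mspace \<Rightarrow> ('a \<Rightarrow> 'c) \<Rightarrow> ('b \<Rightarrow> 'd) \<Rightarrow> ('a, 'b) tensor \<Rightarrow> ('c, 'd) tensor" where
  "tensor_map C D \<phi> \<psi> s = (\<Union>f\<in>s. tensor_rel C D `` {free_map \<phi> \<psi> f})"

lemma free_map_eq:
  assumes "finite K" "Poly_Mapping.keys f \<subseteq> K"
  shows "free_map \<phi> \<psi> f =
    (\<Sum>k\<in>K. Poly_Mapping.single (\<phi> (fst k), \<psi> (snd k)) (Poly_Mapping.lookup f k))"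
  unfolding free_map_def using assms
  by (intro sum.mono_neutral_left) (auto simp: in_keys_iff)

lemma free_map_add: "free_map \<phi> \<psi> (f + g) = free_map \<phi> \<psi> f + free_map \<phi> \<psi> g"
proof -
  let ?K = "Poly_Mapping.keys f \<union> Poly_Mapping.keys g"
  have "Poly_Mapping.keys (f + g) \<subseteq> ?K" by (rule Poly_Mapping.keys_add)
  then show ?thesis
    by (simp add: free_map_eq[of ?K] lookup_add single_add sum.distrib)
qed

lemma free_map_scale: "free_map \<phi> \<psi> (free_scale c f) = free_scale c (free_map \<phi> \<psi> f)"
proof -
  have *: "Poly_Mapping.single k (c * d) = free_scale c (Poly_Mapping.single k d)" for k :: 'z and d
    by (rule poly_mapping_eqI) (simp add: lookup_single when_def)
  have "Poly_Mapping.keys (free_scale c f) \<subseteq> Poly_Mapping.keys f"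
    by (auto simp: in_keys_iff)
  then show ?thesis
    by (simp add: free_map_eq[of "Poly_Mapping.keys f"] * free.scale_sum_right)
qed

lemma free_map_fgen [simp]: "free_map \<phi> \<psi> (fgen v w) = fgen (\<phi> v) (\<psi> w)"
  by (simp add: free_map_def)

lemma free_map_diff: "free_map \<phi> \<psi> (f - g) = free_map \<phi> \<psi> f - free_map \<phi> \<psi> g"
  by (metis add_diff_cancel_right' diff_add_cancel free_map_add)

text \<open>\<open>\<phi> \<otimes> \<psi>\<close> is well defined on equivalence classes.\<close>

lemma free_map_tensor_rel:
  assumes \<phi>: "clinear_between A C \<phi>" and \<psi>: "clinear_between B D \<psi>"
    and fg: "(f, g) \<in> tensor_rel A B"
  shows "(free_map \<phi> \<psi> f, free_map \<phi> \<psi> g) \<in> tensor_rel C D"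
proof -
  have pairs: "free_map \<phi> \<psi> h \<in> free_pairs C D" if "h \<in> free_pairs A B" for h
  proof -
    have "Poly_Mapping.keys (free_map \<phi> \<psi> h) \<subseteq>
        (\<Union>k\<in>Poly_Mapping.keys h. Poly_Mapping.keys
          (Poly_Mapping.single (\<phi> (fst k), \<psi> (snd k)) (Poly_Mapping.lookup h k)))"
      unfolding free_map_def by (rule Poly_Mapping.keys_sum)
    also have "\<dots> \<subseteq> carrier C \<times> carrier D"
    proof (intro UN_least subsetI)
      fix k l
      assume k: "k \<in> Poly_Mapping.keys h"
        and "l \<in> Poly_Mapping.keys
          (Poly_Mapping.single (\<phi> (fst k), \<psi> (snd k)) (Poly_Mapping.lookup h k))"
      then have "l = (\<phi> (fst k), \<psi> (snd k))"
        by (simp split: if_splits)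
      moreover have "k \<in> carrier A \<times> carrier B"
        using that k by (auto simp: free_pairs_def)
      ultimately show "l \<in> carrier C \<times> carrier D"
        using \<phi> \<psi> by (auto simp: clinear_between_def)
    qed
    finally show ?thesis by (simp add: free_pairs_def)
  qed
  have "free_map \<phi> \<psi> h \<in> free.span (bilin_relators C D)"
    if "h \<in> free.span (bilin_relators A B)" for h
    using that
  proof (induction rule: free.span_induct_alt)
    case base
    show ?case by (simp add: free_map_def free.span_zero)
  next
    case (step c x y)
    have "free_map \<phi> \<psi> x \<in> bilin_relators C D"
    proof -
      have mem: "\<phi> v \<in> carrier C" "\<psi> w \<in> carrier D" if "v \<in> carrier A" "w \<in> carrier B" for v w
        using that \<phi> \<psi> by (auto simp: clinear_between_def)
      note lin = \<phi>[unfolded clinear_between_def, THEN conjunct2]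
        \<psi>[unfolded clinear_between_def, THEN conjunct2]
      from step(1) consider
          (l) v v' w where "x = fgen (madd A v v') w - fgen v w - fgen v' w"
            "v \<in> carrier A" "v' \<in> carrier A" "w \<in> carrier B"
        | (r) v w w' where "x = fgen v (madd B w w') - fgen v w - fgen v w'"
            "v \<in> carrier A" "w \<in> carrier B" "w' \<in> carrier B"
        | (sl) c v w where "x = fgen (mscale A c v) w - free_scale c (fgen v w)"
            "v \<in> carrier A" "w \<in> carrier B"
        | (sr) c v w where "x = fgen v (mscale B c w) - free_scale c (fgen v w)"
            "v \<in> carrier A" "w \<in> carrier B"
        unfolding bilin_relators_def by blast
      then show ?thesis
      proof cases
        case l
        then have "free_map \<phi> \<psi> x =
            fgen (madd C (\<phi> v) (\<phi> v')) (\<psi> w) - fgen (\<phi> v) (\<psi> w) - fgen (\<phi> v') (\<psi> w)"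
          using lin by (simp add: free_map_diff)
        then show ?thesis using l(2-) mem unfolding bilin_relators_def by blast
      next
        case r
        then have "free_map \<phi> \<psi> x =
            fgen (\<phi> v) (madd D (\<psi> w) (\<psi> w')) - fgen (\<phi> v) (\<psi> w) - fgen (\<phi> v) (\<psi> w')"
          using lin by (simp add: free_map_diff)
        then show ?thesis using r(2-) mem unfolding bilin_relators_def by blast
      next
        case sl
        then have "free_map \<phi> \<psi> x =
            fgen (mscale C c (\<phi> v)) (\<psi> w) - free_scale c (fgen (\<phi> v) (\<psi> w))"
          using lin by (simp add: free_map_diff free_map_scale)
        then show ?thesis using sl(2-) mem unfolding bilin_relators_def by blast
      next
        case sr
        then have "free_map \<phi> \<psi> x =
            fgen (\<phi> v) (mscale D c (\<psi> w)) - free_scale c (fgen (\<phi> v) (\<psi> w))"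
          using lin by (simp add: free_map_diff free_map_scale)
        then show ?thesis using sr(2-) mem unfolding bilin_relators_def by blast
      qed
    qed
    then show ?case
      using step by (simp add: free_map_add free_map_scale free.span_add free.span_scale free.span_base)
  qed
  then show ?thesis
    using fg pairs by (simp add: tensor_rel_def free_map_diff[symmetric])
qed

lemma tensor_map_class:
  assumes "clinear_between A C \<phi>" "clinear_between B D \<psi>" "f \<in> free_pairs A B"
  shows "tensor_map C D \<phi> \<psi> (tensor_rel A B `` {f}) = tensor_rel C D `` {free_map \<phi> \<psi> f}"
  unfolding tensor_map_def
  using assms
  by (intro UN_equiv_class[OF equiv_tensor_rel])
    (auto intro!: congruentI equiv_class_eq[OF equiv_tensor_rel] free_map_tensor_rel)

lemma tensor_map_elem_tensor:
  assumes "clinear_between A C \<phi>" "clinear_between B D \<psi>" "v \<in> carrier A" "w \<in> carrier B"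
  shows "tensor_map C D \<phi> \<psi> (elem_tensor A B v w) = elem_tensor C D (\<phi> v) (\<psi> w)"
  using assms by (simp add: elem_tensor_def tensor_map_class free_pairs_def)

section \<open>The Schur norms\<close>

primrec msum :: "('a, 'z) cspace_scheme \<Rightarrow> nat \<Rightarrow> (nat \<Rightarrow> 'a) \<Rightarrow> 'a" where
  "msum A 0 f = mzero A"
| "msum A (Suc n) f = madd A (msum A n f) (f n)"

text \<open>
  The entries of \<open>\<alpha>z\<beta>\<close> for \<open>\<alpha> \<in> M\<^sub>p\<^sub>,\<^sub>n(\<complex>)\<close>, \<open>z \<in> M\<^sub>n(A)\<close>, \<open>\<beta> \<in> M\<^sub>n\<^sub>,\<^sub>p(\<complex>)\<close>.
\<close>

definition sandwich ::
  "'a cspace \<Rightarrow> nat \<Rightarrow> (nat \<Rightarrow> nat \<Rightarrow> complex) \<Rightarrow> (nat \<Rightarrow> nat \<Rightarrow> 'a) \<Rightarrow> (nat \<Rightarrow> nat \<Rightarrow> complex) \<Rightarrow>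
    nat \<Rightarrow> nat \<Rightarrow> 'a" where
  "sandwich A n \<alpha> z \<beta> i j =
     msum A n (\<lambda>k. msum A n (\<lambda>l. mscale A (\<alpha> i k * \<beta> l j) (z k l)))"

definition circ_prod ::
  "'a mspace \<Rightarrow> 'b mspace \<Rightarrow> (nat \<Rightarrow> nat \<Rightarrow> 'a) \<Rightarrow> (nat \<Rightarrow> nat \<Rightarrow> 'b) \<Rightarrow> nat \<Rightarrow> nat \<Rightarrow> ('a, 'b) tensor"
  where "circ_prod A B x y = (\<lambda>i j. elem_tensor A B (x i j) (y i j))"

definition schur_norm ::
  "'a mspace \<Rightarrow> 'b mspace \<Rightarrow> nat \<Rightarrow> (nat \<Rightarrow> nat \<Rightarrow> ('a, 'b) tensor) \<Rightarrow> real" where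
  "schur_norm A B p u =
     Inf {cmat_norm p n \<alpha> * mnorm A n x * mnorm B n y * cmat_norm n p \<beta> |n \<alpha> x y \<beta>.
            1 \<le> n \<and> x \<in> mats n A \<and> y \<in> mats n B \<and>
            (\<forall>i<p. \<forall>j<p. u i j = sandwich (tensor_vs A B) n \<alpha> (circ_prod A B x y) \<beta> i j)}"

definition schur_alg :: "'a mspace \<Rightarrow> 'b mspace \<Rightarrow> ('a, 'b) tensor mspace" where
  "schur_alg A B =
     \<lparr>carrier = tensor_carrier A B, mzero = tensor_zero A B, madd = tensor_add A B,
      mscale = tensor_scale A B, mnorm = schur_norm A B\<rparr>"

section \<open>Completion\<close>

text \<open>
  Cauchy sequences modulo null sequences, with respect to the norm of the first matrix level.
  Matrix norms are limits of the matrix norms of representing sequences.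
\<close>

definition mdist :: "'a mspace \<Rightarrow> 'a \<Rightarrow> 'a \<Rightarrow> real" where
  "mdist A x y = mnorm A 1 (\<lambda>_ _. madd A x (mscale A (-1) y))"

definition mcauchy :: "'a mspace \<Rightarrow> (nat \<Rightarrow> 'a) set" where
  "mcauchy A =
     {f. (\<forall>k. f k \<in> carrier A) \<and> (\<forall>e>0. \<exists>N. \<forall>m\<ge>N. \<forall>n\<ge>N. mdist A (f m) (f n) < e)}"

definition compl_rel :: "'a mspace \<Rightarrow> ((nat \<Rightarrow> 'a) \<times> (nat \<Rightarrow> 'a)) set" where
  "compl_rel A =
     {(f, g). f \<in> mcauchy A \<and> g \<in> mcauchy A \<and> (\<lambda>k. mdist A (f k) (g k)) \<longlonglongrightarrow> 0}"

definition compl_embed :: "'a mspace \<Rightarrow> 'a \<Rightarrow> (nat \<Rightarrow> 'a) set" where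
  "compl_embed A x = compl_rel A `` {\<lambda>_. x}"

definition completion :: "'a mspace \<Rightarrow> (nat \<Rightarrow> 'a) set mspace" where
  "completion A =
     \<lparr>carrier = mcauchy A // compl_rel A,
      mzero = compl_embed A (mzero A),
      madd = (\<lambda>X Y. \<Union>f\<in>X. \<Union>g\<in>Y. compl_rel A `` {\<lambda>k. madd A (f k) (g k)}),
      mscale = (\<lambda>c X. \<Union>f\<in>X. compl_rel A `` {\<lambda>k. mscale A c (f k)}),
      mnorm = (\<lambda>n X. lim (\<lambda>k. mnorm A n (\<lambda>i j. (SOME f. f \<in> X i j) k)))\<rparr>"

definition schur_tensor :: "'a mspace \<Rightarrow> 'b mspace \<Rightarrow> (nat \<Rightarrow> ('a, 'b) tensor) set mspace" where
  "schur_tensor A B = completion (schur_alg A B)"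

end

theory Submission
  imports Defs
begin

text \<open>
  A decomposition \<open>u = \<alpha>(x \<circ> y)\<beta>\<close> is carried by \<open>\<phi> \<otimes> \<psi>\<close> to the decomposition
  \<open>\<alpha>(\<phi>(x) \<circ> \<psi>(y))\<beta>\<close>, with the same scalar matrices and with matrices \<open>\<phi>(x)\<close>, \<open>\<psi>(y)\<close> that are no
  larger than \<open>x\<close>, \<open>y\<close>. So \<open>\<phi> \<otimes> \<psi>\<close> does not increase any of the Schur norms on the algebraic tensor
  products. This is the whole idea; the work is to know enough about the Schur norms for the
  completions to be meaningful.

  To this end an infimum of four-fold products is replaced by the predicate \<open>schur_decomp\<close>, in which
  \<open>x\<close> and \<open>y\<close> are contractions and \<open>\<parallel>\<alpha>\<parallel>\<^sup>2\<close>, \<open>\<parallel>\<beta>\<parallel>\<^sup>2\<close> are bounded by the same number \<open>M\<close>. Rescaling shows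
  that the infimum of the admissible \<open>M\<close> is the Schur norm (\<open>schur_decomp_of_norm_less\<close>,
  \<open>schur_norm_le\<close>). In this form the triangle inequality is the observation that two decompositions
  combine to \<open>[\<alpha> \<alpha>'] ((x \<oplus> x') \<circ> (y \<oplus> y')) [\<beta>; \<beta>']\<close>, in which the squared norms of the row and of
  the column add up (\<open>schur_decomp_add\<close>). Placing a decomposition of one tensor in a single matrix
  entry gives both the existence of decompositions and the bound of a matrix norm by the sum of the
  norms of the entries, so that every matrix norm is uniformly continuous for the norm of the first
  level.

  Hence the Schur tensor product is a space in which Cauchy sequences, the algebraic operations and
  the limits of matrix norms behave well (\<open>schur_alg_matrix_pseudometric\<close>), and a linear map between
  two such spaces that decreases all matrix norms extends to the completions by applying it termwise to
  Cauchy sequences (\<open>completion_extension\<close>).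
\<close>

section \<open>Norms of block matrices\<close>

text \<open>
  The operator norm of a matrix of maps between finite Hilbert sums. Both the norm of a scalar matrix and
  the norm of a matrix of operators have this form, and their elementary properties are those of the
  operator norm.
\<close>

definition block_norm ::
  "nat \<Rightarrow> nat \<Rightarrow> (nat \<Rightarrow> nat \<Rightarrow> 'a::real_normed_vector \<Rightarrow> 'b::real_normed_vector) \<Rightarrow> real" where
  "block_norm p n T =
     (SUP z\<in>{z. L2_set (\<lambda>j. norm (z j)) {..<n} \<le> 1}.
        L2_set (\<lambda>i. norm (\<Sum>j<n. T i j (z j))) {..<p})"

lemma cmat_norm_eq_block_norm: "cmat_norm p n \<alpha> = block_norm p n (\<lambda>i j. (*) (\<alpha> i j))"
  by (simp add: cmat_norm_def block_norm_def)

lemma op_mnorm_eq_block_norm: "op_mnorm n x = block_norm n n (\<lambda>i j. blinfun_apply (x i j))"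
  by (simp add: op_mnorm_def block_norm_def)

text \<open>
  This crude bound makes the supremum in \<open>block_norm\<close> a genuine one.
\<close>

lemma block_matrix_bounded:
  fixes T :: "nat \<Rightarrow> nat \<Rightarrow> 'a::real_normed_vector \<Rightarrow> 'b::real_normed_vector"
  assumes "\<And>i j. bounded_linear (T i j)"
  shows "\<exists>K\<ge>0. \<forall>z.
    L2_set (\<lambda>i. norm (\<Sum>j<n. T i j (z j))) {..<p} \<le> K * L2_set (\<lambda>j. norm (z j)) {..<n}"
proof (intro exI conjI allI)
  let ?K = "\<Sum>i<p. \<Sum>j<n. onorm (T i j)"
  show "?K \<ge> 0"
    by (intro sum_nonneg onorm_pos_le assms)
  fix z :: "nat \<Rightarrow> 'a"
  have "L2_set (\<lambda>i. norm (\<Sum>j<n. T i j (z j))) {..<p} \<le> (\<Sum>i<p. norm (\<Sum>j<n. T i j (z j)))"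
    by (rule L2_set_le_sum) simp
  also have "\<dots> \<le> (\<Sum>i<p. \<Sum>j<n. onorm (T i j) * L2_set (\<lambda>j. norm (z j)) {..<n})"
  proof (rule sum_mono, rule sum_norm_le)
    fix i j assume "j \<in> {..<n}"
    have "norm (T i j (z j)) \<le> onorm (T i j) * norm (z j)"
      by (rule onorm[OF assms])
    also have "\<dots> \<le> onorm (T i j) * L2_set (\<lambda>j. norm (z j)) {..<n}"
      using \<open>j \<in> {..<n}\<close>
      by (intro mult_left_mono onorm_pos_le assms) (auto intro: member_le_L2_set)
    finally show "norm (T i j (z j)) \<le> onorm (T i j) * L2_set (\<lambda>j. norm (z j)) {..<n}" .
  qed
  also have "\<dots> = ?K * L2_set (\<lambda>j. norm (z j)) {..<n}"
    by (simp add: sum_distrib_right)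
  finally show "L2_set (\<lambda>i. norm (\<Sum>j<n. T i j (z j))) {..<p}
      \<le> ?K * L2_set (\<lambda>j. norm (z j)) {..<n}" .
qed

lemma block_norm_le:
  fixes T :: "nat \<Rightarrow> nat \<Rightarrow> 'a::real_normed_vector \<Rightarrow> 'b::real_normed_vector"
  assumes "K \<ge> 0"
    and "\<And>z. L2_set (\<lambda>i. norm (\<Sum>j<n. T i j (z j))) {..<p} \<le> K * L2_set (\<lambda>j. norm (z j)) {..<n}"
  shows "block_norm p n T \<le> K"
  unfolding block_norm_def
proof (rule cSUP_least)
  show "{z. L2_set (\<lambda>j. norm (z j)) {..<n} \<le> 1} \<noteq> {}"
    by (auto intro!: exI[of _ "\<lambda>_. 0"] simp: L2_set_def)
  fix z :: "nat \<Rightarrow> 'a" assume "z \<in> {z. L2_set (\<lambda>j. norm (z j)) {..<n} \<le> 1}"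
  then show "L2_set (\<lambda>i. norm (\<Sum>j<n. T i j (z j))) {..<p} \<le> K"
    using assms(2)[of z] mult_left_mono[of "L2_set (\<lambda>j. norm (z j)) {..<n}" 1 K] assms(1)
    by auto
qed

context
  fixes T :: "nat \<Rightarrow> nat \<Rightarrow> 'a::real_normed_vector \<Rightarrow> 'b::real_normed_vector"
  assumes bl: "\<And>i j. bounded_linear (T i j)"
begin

lemma block_norm_upper:
  assumes "L2_set (\<lambda>j. norm (z j)) {..<n} \<le> 1"
  shows "L2_set (\<lambda>i. norm (\<Sum>j<n. T i j (z j))) {..<p} \<le> block_norm p n T"
  unfolding block_norm_def
proof (rule cSUP_upper)
  obtain K where K: "K \<ge> 0"
    "\<And>z. L2_set (\<lambda>i. norm (\<Sum>j<n. T i j (z j))) {..<p} \<le> K * L2_set (\<lambda>j. norm (z j)) {..<n}"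
    using block_matrix_bounded[where T = T and n = n and p = p, OF bl] by blast
  have "L2_set (\<lambda>i. norm (\<Sum>j<n. T i j (z j))) {..<p} \<le> K"
    if "L2_set (\<lambda>j. norm (z j)) {..<n} \<le> 1" for z
    using K(2)[of z] mult_left_mono[OF that K(1)] by simp
  then show "bdd_above ((\<lambda>z. L2_set (\<lambda>i. norm (\<Sum>j<n. T i j (z j))) {..<p}) `
      {z. L2_set (\<lambda>j. norm (z j)) {..<n} \<le> 1})"
    by (intro bdd_aboveI2[where M = K]) auto
qed (use assms in simp)

lemma block_norm_nonneg: "block_norm p n T \<ge> 0"
proof -
  have "0 \<le> L2_set (\<lambda>i. norm (\<Sum>j<n. T i j 0)) {..<p}"
    by (rule L2_set_nonneg)
  also have "\<dots> \<le> block_norm p n T"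
    by (rule block_norm_upper) (simp add: L2_set_def)
  finally show ?thesis .
qed

lemma block_norm_apply:
  "L2_set (\<lambda>i. norm (\<Sum>j<n. T i j (z j))) {..<p} \<le> block_norm p n T * L2_set (\<lambda>j. norm (z j)) {..<n}"
proof (cases "L2_set (\<lambda>j. norm (z j)) {..<n} = 0")
  case True
  obtain K where "K \<ge> 0"
    "\<And>z. L2_set (\<lambda>i. norm (\<Sum>j<n. T i j (z j))) {..<p} \<le> K * L2_set (\<lambda>j. norm (z j)) {..<n}"
    using block_matrix_bounded[where T = T and n = n and p = p, OF bl] by blast
  from this(2)[of z] show ?thesis by (simp add: True)
next
  case False
  define r where "r = L2_set (\<lambda>j. norm (z j)) {..<n}"
  have r: "r > 0" using False L2_set_nonneg[of "\<lambda>j. norm (z j)" "{..<n}"] unfolding r_def by linarith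
  have "L2_set (\<lambda>j. norm (inverse r *\<^sub>R z j)) {..<n} = inverse r * r"
    using r by (simp add: L2_set_right_distrib r_def)
  then have "L2_set (\<lambda>i. norm (\<Sum>j<n. T i j (inverse r *\<^sub>R z j))) {..<p} \<le> block_norm p n T"
    using r by (intro block_norm_upper) simp
  also have "(\<lambda>i. norm (\<Sum>j<n. T i j (inverse r *\<^sub>R z j)))
      = (\<lambda>i. inverse r * norm (\<Sum>j<n. T i j (z j)))"
    using r by (simp add: linear_cmul[OF bounded_linear.linear[OF bl]] scaleR_sum_right[symmetric])
  also have "L2_set \<dots> {..<p} = inverse r * L2_set (\<lambda>i. norm (\<Sum>j<n. T i j (z j))) {..<p}"
    using r by (simp add: L2_set_right_distrib)
  finally show ?thesis
    using r by (simp add: r_def[symmetric] divide_simps mult.commute)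
qed

end

lemma cmat_norm_le:
  assumes "K \<ge> 0"
    and "\<And>z. L2_set (\<lambda>i. cmod (\<Sum>j<n. \<alpha> i j * z j)) {..<p} \<le> K * L2_set (\<lambda>j. cmod (z j)) {..<n}"
  shows "cmat_norm p n \<alpha> \<le> K"
  unfolding cmat_norm_eq_block_norm using assms by (rule block_norm_le)

lemma cmat_norm_apply:
  "L2_set (\<lambda>i. cmod (\<Sum>j<n. \<alpha> i j * z j)) {..<p} \<le> cmat_norm p n \<alpha> * L2_set (\<lambda>j. cmod (z j)) {..<n}"
  unfolding cmat_norm_eq_block_norm by (rule block_norm_apply[OF bounded_linear_mult_right])

lemma cmat_norm_nonneg: "0 \<le> cmat_norm p n \<alpha>"
  unfolding cmat_norm_eq_block_norm by (rule block_norm_nonneg[OF bounded_linear_mult_right])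

lemma op_mnorm_le:
  fixes x :: "nat \<Rightarrow> nat \<Rightarrow> 'h::chilbert_space \<Rightarrow>\<^sub>L 'h"
  assumes "K \<ge> 0"
    and "\<And>z. L2_set (\<lambda>i. norm (\<Sum>j<n. blinfun_apply (x i j) (z j))) {..<n}
        \<le> K * L2_set (\<lambda>j. norm (z j)) {..<n}"
  shows "op_mnorm n x \<le> K"
  unfolding op_mnorm_eq_block_norm using assms by (rule block_norm_le)

lemma op_mnorm_apply:
  fixes x :: "nat \<Rightarrow> nat \<Rightarrow> 'h::chilbert_space \<Rightarrow>\<^sub>L 'h"
  shows "L2_set (\<lambda>i. norm (\<Sum>j<n. blinfun_apply (x i j) (z j))) {..<n}
      \<le> op_mnorm n x * L2_set (\<lambda>j. norm (z j)) {..<n}"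
  unfolding op_mnorm_eq_block_norm by (rule block_norm_apply[OF blinfun.bounded_linear_right])

lemma op_mnorm_nonneg:
  fixes x :: "nat \<Rightarrow> nat \<Rightarrow> 'h::chilbert_space \<Rightarrow>\<^sub>L 'h"
  shows "0 \<le> op_mnorm n x"
  unfolding op_mnorm_eq_block_norm by (rule block_norm_nonneg[OF blinfun.bounded_linear_right])

lemma sum_lessThan_add: "sum f {..<m + n} = sum f {..<m} + (\<Sum>i<n. f (m + i))"
  for f :: "nat \<Rightarrow> 'a::comm_monoid_add"
  by (induction n) (simp_all add: add.assoc)

lemma L2_set_lessThan_add_power2:
  "(L2_set f {..<m + n})\<^sup>2 = (L2_set f {..<m})\<^sup>2 + (L2_set (\<lambda>i. f (m + i)) {..<n})\<^sup>2"
  for f :: "nat \<Rightarrow> real"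
  by (simp add: L2_set_def sum_nonneg sum_lessThan_add)

lemma cmat_norm_scale_le: "cmat_norm p n (\<lambda>i j. c * \<alpha> i j) \<le> cmod c * cmat_norm p n \<alpha>"
proof (rule cmat_norm_le)
  fix z
  have "L2_set (\<lambda>i. cmod (\<Sum>j<n. c * \<alpha> i j * z j)) {..<p}
      = cmod c * L2_set (\<lambda>i. cmod (\<Sum>j<n. \<alpha> i j * z j)) {..<p}"
    by (simp add: mult.assoc sum_distrib_left[symmetric] norm_mult L2_set_right_distrib)
  also have "\<dots> \<le> cmod c * (cmat_norm p n \<alpha> * L2_set (\<lambda>j. cmod (z j)) {..<n})"
    by (intro mult_left_mono cmat_norm_apply) simp
  finally show "L2_set (\<lambda>i. cmod (\<Sum>j<n. c * \<alpha> i j * z j)) {..<p}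
      \<le> cmod c * cmat_norm p n \<alpha> * L2_set (\<lambda>j. cmod (z j)) {..<n}"
    by (simp add: mult.assoc)
qed (simp add: cmat_norm_nonneg)

text \<open>
  For a row \<open>[\<alpha> \<alpha>']\<close> the image of \<open>z \<oplus> z'\<close> is \<open>\<alpha>z + \<alpha>'z'\<close>, which the Cauchy--Schwarz inequality bounds
  by \<open>(\<parallel>\<alpha>\<parallel>\<^sup>2 + \<parallel>\<alpha>'\<parallel>\<^sup>2)\<^sup>1\<^sup>/\<^sup>2\<close> times the norm of \<open>z \<oplus> z'\<close>; for a column the two components of the image are
  orthogonal. This additivity of the squares is the source of the triangle inequality for the Schur
  norm.
\<close>

lemma cmat_norm_row_power2_le:
  assumes a: "(cmat_norm p m \<alpha>)\<^sup>2 \<le> M" and a': "(cmat_norm p n \<alpha>')\<^sup>2 \<le> N"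
  shows "(cmat_norm p (m + n) (\<lambda>i k. if k < m then \<alpha> i k else \<alpha>' i (k - m)))\<^sup>2 \<le> M + N"
proof -
  let ?\<gamma> = "\<lambda>i k. if k < m then \<alpha> i k else \<alpha>' i (k - m)"
  have MN: "M \<ge> 0" "N \<ge> 0" using order_trans[OF zero_le_power2 a] order_trans[OF zero_le_power2 a'] by simp_all
  have "cmat_norm p (m + n) ?\<gamma> \<le> sqrt (M + N)"
  proof (rule cmat_norm_le)
    fix z :: "nat \<Rightarrow> complex"
    let ?r = "L2_set (\<lambda>j. cmod (z j)) {..<m}" and ?s = "L2_set (\<lambda>j. cmod (z (m + j))) {..<n}"
    have "L2_set (\<lambda>i. cmod (\<Sum>j<m + n. ?\<gamma> i j * z j)) {..<p}
        \<le> L2_set (\<lambda>i. cmod (\<Sum>j<m. \<alpha> i j * z j) + cmod (\<Sum>j<n. \<alpha>' i j * z (m + j))) {..<p}"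
      by (rule L2_set_mono) (auto simp: sum_lessThan_add intro: norm_triangle_ineq)
    also have "\<dots> \<le> L2_set (\<lambda>i. cmod (\<Sum>j<m. \<alpha> i j * z j)) {..<p}
        + L2_set (\<lambda>i. cmod (\<Sum>j<n. \<alpha>' i j * z (m + j))) {..<p}"
      by (rule L2_set_triangle_ineq)
    also have "\<dots> \<le> cmat_norm p m \<alpha> * ?r + cmat_norm p n \<alpha>' * ?s"
      by (intro add_mono cmat_norm_apply)
    also have "\<dots> \<le> sqrt M * ?r + sqrt N * ?s"
      using a a' by (intro add_mono mult_right_mono L2_set_nonneg real_le_rsqrt)
    \<comment> \<open>the Cauchy--Schwarz inequality in the plane\<close>
    also have "\<dots> \<le> sqrt ((sqrt M)\<^sup>2 + (sqrt N)\<^sup>2) * sqrt (?r\<^sup>2 + ?s\<^sup>2)"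
    proof -
      have "(a * r + b * s)\<^sup>2 \<le> (a\<^sup>2 + b\<^sup>2) * (r\<^sup>2 + s\<^sup>2)" for a b r s :: real
        using zero_le_power2[of "a * s - b * r"] by (simp add: power2_eq_square algebra_simps)
      from this[of "sqrt M" ?r "sqrt N" ?s] show ?thesis
        unfolding real_sqrt_mult[symmetric] by (rule real_le_rsqrt)
    qed
    also have "sqrt (?r\<^sup>2 + ?s\<^sup>2) = L2_set (\<lambda>j. cmod (z j)) {..<m + n}"
      by (simp add: L2_set_lessThan_add_power2[of "\<lambda>j. cmod (z j)", symmetric] L2_set_nonneg)
    finally show "L2_set (\<lambda>i. cmod (\<Sum>j<m + n. ?\<gamma> i j * z j)) {..<p}
        \<le> sqrt (M + N) * L2_set (\<lambda>j. cmod (z j)) {..<m + n}"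
      using MN by simp
  qed (use MN in simp)
  then show ?thesis
    using power_mono[OF _ cmat_norm_nonneg, of p "m + n" ?\<gamma> "sqrt (M + N)" 2] MN by simp
qed

lemma cmat_norm_column_power2_le:
  assumes b: "(cmat_norm m p \<beta>)\<^sup>2 \<le> M" and b': "(cmat_norm n p \<beta>')\<^sup>2 \<le> N"
  shows "(cmat_norm (m + n) p (\<lambda>k j. if k < m then \<beta> k j else \<beta>' (k - m) j))\<^sup>2 \<le> M + N"
proof -
  let ?\<gamma> = "\<lambda>k j. if k < m then \<beta> k j else \<beta>' (k - m) j"
  have MN: "M \<ge> 0" "N \<ge> 0" using order_trans[OF zero_le_power2 b] order_trans[OF zero_le_power2 b'] by simp_all
  have "cmat_norm (m + n) p ?\<gamma> \<le> sqrt (M + N)"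
  proof (rule cmat_norm_le)
    fix z :: "nat \<Rightarrow> complex"
    let ?r = "L2_set (\<lambda>j. cmod (z j)) {..<p}"
    have sq: "(L2_set (\<lambda>i. cmod (\<Sum>j<p. \<delta> i j * z j)) {..<q})\<^sup>2 \<le> L * ?r\<^sup>2"
      if "(cmat_norm q p \<delta>)\<^sup>2 \<le> L" for q \<delta> L
    proof -
      have "(L2_set (\<lambda>i. cmod (\<Sum>j<p. \<delta> i j * z j)) {..<q})\<^sup>2 \<le> (cmat_norm q p \<delta> * ?r)\<^sup>2"
        by (intro power_mono cmat_norm_apply L2_set_nonneg)
      also have "\<dots> \<le> L * ?r\<^sup>2"
        using that by (simp add: power_mult_distrib mult_right_mono)
      finally show ?thesis .
    qed
    have "(L2_set (\<lambda>i. cmod (\<Sum>j<p. ?\<gamma> i j * z j)) {..<m + n})\<^sup>2 \<le> M * ?r\<^sup>2 + N * ?r\<^sup>2"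
      unfolding L2_set_lessThan_add_power2
      using sq[OF b] sq[OF b'] by (intro add_mono) (simp_all cong: L2_set_cong_simp)
    then have "L2_set (\<lambda>i. cmod (\<Sum>j<p. ?\<gamma> i j * z j)) {..<m + n} \<le> sqrt ((M + N) * ?r\<^sup>2)"
      by (intro real_le_rsqrt) (simp add: distrib_right)
    then show "L2_set (\<lambda>i. cmod (\<Sum>j<p. ?\<gamma> i j * z j)) {..<m + n} \<le> sqrt (M + N) * ?r"
      by (simp add: real_sqrt_mult L2_set_nonneg)
  qed (use MN in simp)
  then show ?thesis
    using power_mono[OF _ cmat_norm_nonneg, of "m + n" p ?\<gamma> "sqrt (M + N)" 2] MN by simp
qed

lemma cmat_norm_single_row_le:
  "cmat_norm p n (\<lambda>i k. if i = i0 then \<alpha> 0 k else 0) \<le> cmat_norm 1 n \<alpha>"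
proof (rule cmat_norm_le)
  fix z
  have "L2_set (\<lambda>i. cmod (\<Sum>j<n. (if i = i0 then \<alpha> 0 j else 0) * z j)) {..<p}
    = L2_set (\<lambda>i. if i = i0 then cmod (\<Sum>j<n. \<alpha> 0 j * z j) else 0) {..<p}"
    by (rule arg_cong2[where f = L2_set]) auto
  also have "\<dots> \<le> cmod (\<Sum>j<n. \<alpha> 0 j * z j)"
    by (simp add: L2_set_def if_distrib[of "\<lambda>x. x\<^sup>2"] cong: if_cong)
  also have "\<dots> = L2_set (\<lambda>i. cmod (\<Sum>j<n. \<alpha> i j * z j)) {..<1}"
    by (simp add: L2_set_def)
  also have "\<dots> \<le> cmat_norm 1 n \<alpha> * L2_set (\<lambda>j. cmod (z j)) {..<n}"
    by (rule cmat_norm_apply)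
  finally show "L2_set (\<lambda>i. cmod (\<Sum>j<n. (if i = i0 then \<alpha> 0 j else 0) * z j)) {..<p}
      \<le> cmat_norm 1 n \<alpha> * L2_set (\<lambda>j. cmod (z j)) {..<n}" .
qed (rule cmat_norm_nonneg)

lemma cmat_norm_single_column_le:
  "cmat_norm n p (\<lambda>k j. if j = j0 then \<beta> k 0 else 0) \<le> cmat_norm n 1 \<beta>"
proof (cases "j0 < p")
  case False
  then show ?thesis
    using cmat_norm_nonneg[of n 1 \<beta>]
    by (intro cmat_norm_le) (auto simp: L2_set_def sum_nonneg intro!: mult_nonneg_nonneg)
next
  case True
  show ?thesis
  proof (rule cmat_norm_le)
    fix z
    have "L2_set (\<lambda>i. cmod (\<Sum>j<p. (if j = j0 then \<beta> i 0 else 0) * z j)) {..<n}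
      = L2_set (\<lambda>i. cmod (\<Sum>j<1. \<beta> i j * z j0)) {..<n}"
      using True by (simp add: if_distrib[of "\<lambda>x. x * _"] cong: if_cong)
    also have "\<dots> \<le> cmat_norm n 1 \<beta> * L2_set (\<lambda>_. cmod (z j0)) {..<1::nat}"
      by (rule cmat_norm_apply[where z = "\<lambda>_. z j0"])
    also have "L2_set (\<lambda>_. cmod (z j0)) {..<1::nat} = cmod (z j0)"
      by (simp add: L2_set_def)
    also have "cmat_norm n 1 \<beta> * cmod (z j0) \<le> cmat_norm n 1 \<beta> * L2_set (\<lambda>j. cmod (z j)) {..<p}"
      using True by (intro mult_left_mono cmat_norm_nonneg member_le_L2_set) auto
    finally show "L2_set (\<lambda>i. cmod (\<Sum>j<p. (if j = j0 then \<beta> i 0 else 0) * z j)) {..<n}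
        \<le> cmat_norm n 1 \<beta> * L2_set (\<lambda>j. cmod (z j)) {..<p}" .
  qed (rule cmat_norm_nonneg)
qed

section \<open>Scalars and direct sums in matrix-normed spaces\<close>

definition direct_sum ::
  "'a mspace \<Rightarrow> nat \<Rightarrow> (nat \<Rightarrow> nat \<Rightarrow> 'a) \<Rightarrow> (nat \<Rightarrow> nat \<Rightarrow> 'a) \<Rightarrow> nat \<Rightarrow> nat \<Rightarrow> 'a" where
  "direct_sum A m x y = (\<lambda>i j.
     if i < m \<and> j < m then x i j
     else if m \<le> i \<and> m \<le> j then y (i - m) (j - m) else mzero A)"

text \<open>
  The part of the structure of an operator space that the Schur norm uses: scalars act on matrices with
  the expected bound, and direct sums satisfy Ruan's inequality.
\<close>

locale matricial_space =
  fixes A :: "'a mspace"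
  assumes zero_closed: "mzero A \<in> carrier A"
    and scale_closed: "v \<in> carrier A \<Longrightarrow> mscale A c v \<in> carrier A"
    and scale_zero: "v \<in> carrier A \<Longrightarrow> mscale A 0 v = mzero A"
    and mnorm_nonneg: "x \<in> mats n A \<Longrightarrow> 0 \<le> mnorm A n x"
    and mnorm_scale_le:
      "x \<in> mats n A \<Longrightarrow> mnorm A n (\<lambda>i j. mscale A c (x i j)) \<le> cmod c * mnorm A n x"
    and mnorm_direct_sum_le:
      "x \<in> mats m A \<Longrightarrow> y \<in> mats n A \<Longrightarrow>
        mnorm A (m + n) (direct_sum A m x y) \<le> max (mnorm A m x) (mnorm A n y)"
begin

lemma scale_mats: "x \<in> mats n A \<Longrightarrow> (\<lambda>i j. mscale A c (x i j)) \<in> mats n A"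
  by (simp add: mats_def scale_closed)

lemma direct_sum_mats:
  "x \<in> mats m A \<Longrightarrow> y \<in> mats n A \<Longrightarrow> direct_sum A m x y \<in> mats (m + n) A"
  by (auto simp: mats_def direct_sum_def zero_closed)

lemma mnorm_zero_le: "mnorm A n (\<lambda>_ _. mzero A) \<le> 0"
  using mnorm_scale_le[of "\<lambda>_ _. mzero A" n 0] by (simp add: mats_def zero_closed scale_zero)

end

text \<open>
  For the direct sum, \<open>x \<oplus> y\<close> acts on the two orthogonal summands of \<open>H\<^sup>m\<^sup>+\<^sup>n\<close> separately.
\<close>

lemma op_mspace_matricial:
  assumes "operator_space V"
  shows "matricial_space (op_mspace V)"
proof
  have scale0: "scaleC_op 0 v = 0" for v :: "'a \<Rightarrow>\<^sub>L 'a"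
  proof (rule blinfun_eqI)
    show "blinfun_apply (scaleC_op 0 v) x = blinfun_apply 0 x" for x
      using scaleR_scaleC[of 0 "blinfun_apply v x"] by simp
  qed
  show "mzero (op_mspace V) \<in> carrier (op_mspace V)"
    using assms by (simp add: op_mspace_def operator_space_def)
  show "mscale (op_mspace V) c v \<in> carrier (op_mspace V)" if "v \<in> carrier (op_mspace V)" for v c
    using assms that by (simp add: op_mspace_def operator_space_def)
  show "mscale (op_mspace V) 0 v = mzero (op_mspace V)" for v
    by (simp add: op_mspace_def scale0)
  show "0 \<le> mnorm (op_mspace V) n x" for n x
    by (simp add: op_mspace_def op_mnorm_nonneg)
  show "mnorm (op_mspace V) n (\<lambda>i j. mscale (op_mspace V) c (x i j)) \<le> cmod c * mnorm (op_mspace V) n x"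
    for n c x
  proof -
    have "op_mnorm n (\<lambda>i j. scaleC_op c (x i j)) \<le> cmod c * op_mnorm n x"
    proof (rule op_mnorm_le)
      fix z :: "nat \<Rightarrow> 'a"
      have "(\<Sum>j<n. c *\<^sub>C blinfun_apply (x i j) (z j)) = c *\<^sub>C (\<Sum>j<n. blinfun_apply (x i j) (z j))" for i
        by (simp add: linear_sum[OF bounded_linear.linear[OF bounded_linear_scaleC]])
      then have "L2_set (\<lambda>i. norm (\<Sum>j<n. blinfun_apply (scaleC_op c (x i j)) (z j))) {..<n}
          = cmod c * L2_set (\<lambda>i. norm (\<Sum>j<n. blinfun_apply (x i j) (z j))) {..<n}"
        by (simp add: norm_scaleC L2_set_right_distrib)
      also have "\<dots> \<le> cmod c * (op_mnorm n x * L2_set (\<lambda>j. norm (z j)) {..<n})"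
        by (intro mult_left_mono op_mnorm_apply) simp
      finally show "L2_set (\<lambda>i. norm (\<Sum>j<n. blinfun_apply (scaleC_op c (x i j)) (z j))) {..<n}
          \<le> cmod c * op_mnorm n x * L2_set (\<lambda>j. norm (z j)) {..<n}"
        by (simp add: mult.assoc)
    qed (simp add: op_mnorm_nonneg)
    then show ?thesis by (simp add: op_mspace_def)
  qed
  show "mnorm (op_mspace V) (m + n) (direct_sum (op_mspace V) m x y)
      \<le> max (mnorm (op_mspace V) m x) (mnorm (op_mspace V) n y)" for m n x y
  proof -
    let ?d = "direct_sum (op_mspace V) m x y" and ?K = "max (op_mnorm m x) (op_mnorm n y)"
    have K: "?K \<ge> 0" using op_mnorm_nonneg[of m x] by linarith
    have "op_mnorm (m + n) ?d \<le> ?K"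
    proof (rule op_mnorm_le[OF K])
      fix z :: "nat \<Rightarrow> 'a"
      let ?r = "L2_set (\<lambda>j. norm (z j)) {..<m}" and ?s = "L2_set (\<lambda>j. norm (z (m + j))) {..<n}"
      have sq: "(L2_set (\<lambda>i. norm (\<Sum>j<q. blinfun_apply (t i j) (w j))) {..<q})\<^sup>2
          \<le> ?K\<^sup>2 * (L2_set (\<lambda>j. norm (w j)) {..<q})\<^sup>2" if "op_mnorm q t \<le> ?K" for q t and w :: "nat \<Rightarrow> 'a"
      proof -
        have "L2_set (\<lambda>i. norm (\<Sum>j<q. blinfun_apply (t i j) (w j))) {..<q}
            \<le> op_mnorm q t * L2_set (\<lambda>j. norm (w j)) {..<q}"
          by (rule op_mnorm_apply)
        also have "\<dots> \<le> ?K * L2_set (\<lambda>j. norm (w j)) {..<q}"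
          using that by (intro mult_right_mono L2_set_nonneg)
        finally show ?thesis
          unfolding power_mult_distrib[symmetric] by (intro power_mono L2_set_nonneg)
      qed
      have zm: "mzero (op_mspace V) = 0" by (simp add: op_mspace_def)
      have top: "(\<Sum>j<m + n. blinfun_apply (?d i j) (z j)) = (\<Sum>j<m. blinfun_apply (x i j) (z j))"
        if "i < m" for i
        using that by (simp add: sum_lessThan_add direct_sum_def zm)
      have bot: "(\<Sum>j<m + n. blinfun_apply (?d (m + i) j) (z j)) = (\<Sum>j<n. blinfun_apply (y i j) (z (m + j)))"
        for i
        by (simp add: sum_lessThan_add direct_sum_def zm)
      have "(L2_set (\<lambda>i. norm (\<Sum>j<m + n. blinfun_apply (?d i j) (z j))) {..<m + n})\<^sup>2
          \<le> ?K\<^sup>2 * ?r\<^sup>2 + ?K\<^sup>2 * ?s\<^sup>2"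
        unfolding L2_set_lessThan_add_power2 bot
        using sq[of m x z] sq[of n y "\<lambda>j. z (m + j)"]
        by (intro add_mono) (simp_all add: top cong: L2_set_cong_simp)
      also have "\<dots> = (?K * L2_set (\<lambda>j. norm (z j)) {..<m + n})\<^sup>2"
        by (simp add: power_mult_distrib L2_set_lessThan_add_power2 distrib_left)
      finally show "L2_set (\<lambda>i. norm (\<Sum>j<m + n. blinfun_apply (?d i j) (z j))) {..<m + n}
          \<le> ?K * L2_set (\<lambda>j. norm (z j)) {..<m + n}"
        using K by (rule power2_le_imp_le[OF _ mult_nonneg_nonneg[OF _ L2_set_nonneg]])
    qed
    then show ?thesis by (simp add: op_mspace_def)
  qed
qed

section \<open>Calculus in the algebraic tensor product\<close>

abbreviation tensor_class :: "'a mspace \<Rightarrow> 'b mspace \<Rightarrow> ('a \<times> 'b \<Rightarrow>\<^sub>0 complex) \<Rightarrow> ('a, 'b) tensor" where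
  "tensor_class A B f \<equiv> tensor_rel A B `` {f}"

abbreviation relator_span :: "'a mspace \<Rightarrow> 'b mspace \<Rightarrow> ('a \<times> 'b \<Rightarrow>\<^sub>0 complex) set" where
  "relator_span A B \<equiv> free.span (bilin_relators A B)"

lemma subspace_free_pairs: "free.subspace (free_pairs A B)"
proof (rule free.subspaceI)
  show "0 \<in> free_pairs A B" by (simp add: free_pairs_def)
  show "f + g \<in> free_pairs A B" if "f \<in> free_pairs A B" "g \<in> free_pairs A B" for f g
    using that Poly_Mapping.keys_add[of f g] by (fastforce simp: free_pairs_def)
  show "free_scale c f \<in> free_pairs A B" if "f \<in> free_pairs A B" for c f
    using that by (auto simp: free_pairs_def in_keys_iff)
qed

lemmas free_pairs_add = free.subspace_add[OF subspace_free_pairs]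
lemmas free_pairs_diff = free.subspace_diff[OF subspace_free_pairs]
lemmas free_pairs_scale = free.subspace_scale[OF subspace_free_pairs]
lemmas free_pairs_sum = free.subspace_sum[OF subspace_free_pairs]
lemmas free_pairs_zero = free.subspace_0[OF subspace_free_pairs]

lemma fgen_free_pairs: "v \<in> carrier A \<Longrightarrow> w \<in> carrier B \<Longrightarrow> fgen v w \<in> free_pairs A B"
  by (simp add: free_pairs_def)

lemma tensor_class_eqI:
  assumes "f \<in> free_pairs A B" "g \<in> free_pairs A B" "f - g \<in> relator_span A B"
  shows "tensor_class A B f = tensor_class A B g"
  using assms by (intro equiv_class_eq[OF equiv_tensor_rel]) (simp add: tensor_rel_def)

lemma tensor_class_carrier: "f \<in> free_pairs A B \<Longrightarrow> tensor_class A B f \<in> tensor_carrier A B"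
  unfolding tensor_carrier_def by (rule quotientI)

lemma tensor_carrierE:
  assumes "s \<in> tensor_carrier A B"
  obtains f where "f \<in> free_pairs A B" "s = tensor_class A B f"
  using assms unfolding tensor_carrier_def by (rule quotientE)

lemma tensor_add_class:
  assumes "f \<in> free_pairs A B" "g \<in> free_pairs A B"
  shows "tensor_add A B (tensor_class A B f) (tensor_class A B g) = tensor_class A B (f + g)"
  unfolding tensor_add_def
proof (rule UN_equiv_class2[OF equiv_tensor_rel equiv_tensor_rel _ assms])
  show "congruent2 (tensor_rel A B) (tensor_rel A B) (\<lambda>f g. tensor_class A B (f + g))"
  proof (rule congruent2I', rule tensor_class_eqI)
    fix f f' g g' assume fg: "(f, f') \<in> tensor_rel A B" "(g, g') \<in> tensor_rel A B"
    show "f + g \<in> free_pairs A B" "f' + g' \<in> free_pairs A B"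
      using fg by (auto simp: tensor_rel_def intro: free_pairs_add)
    have "(f - f') + (g - g') \<in> relator_span A B"
      using fg by (intro free.span_add) (auto simp: tensor_rel_def)
    then show "f + g - (f' + g') \<in> relator_span A B"
      by (simp add: algebra_simps)
  qed
qed

lemma tensor_scale_class:
  assumes "f \<in> free_pairs A B"
  shows "tensor_scale A B c (tensor_class A B f) = tensor_class A B (free_scale c f)"
  unfolding tensor_scale_def
proof (rule UN_equiv_class[OF equiv_tensor_rel _ assms])
  show "congruent (tensor_rel A B) (\<lambda>f. tensor_class A B (free_scale c f))"
  proof (rule congruentI, rule tensor_class_eqI)
    fix f f' assume f: "(f, f') \<in> tensor_rel A B"
    show "free_scale c f \<in> free_pairs A B" "free_scale c f' \<in> free_pairs A B"
      using f by (auto simp: tensor_rel_def intro: free_pairs_scale)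
    show "free_scale c f - free_scale c f' \<in> relator_span A B"
      using f by (auto simp: tensor_rel_def free.scale_right_diff_distrib[symmetric] intro: free.span_scale)
  qed
qed

lemma tensor_add_carrier:
  assumes "s \<in> tensor_carrier A B" "t \<in> tensor_carrier A B"
  shows "tensor_add A B s t \<in> tensor_carrier A B"
  using assms
  by (auto elim!: tensor_carrierE simp: tensor_add_class intro!: tensor_class_carrier free_pairs_add)

lemma tensor_scale_carrier:
  assumes "s \<in> tensor_carrier A B"
  shows "tensor_scale A B c s \<in> tensor_carrier A B"
  using assms
  by (auto elim!: tensor_carrierE simp: tensor_scale_class intro!: tensor_class_carrier free_pairs_scale)

lemma tensor_zero_carrier: "tensor_zero A B \<in> tensor_carrier A B"
  unfolding tensor_zero_def by (rule tensor_class_carrier[OF free_pairs_zero])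

lemma tensor_add_zero_left: "s \<in> tensor_carrier A B \<Longrightarrow> tensor_add A B (tensor_zero A B) s = s"
  unfolding tensor_zero_def by (auto elim!: tensor_carrierE simp: tensor_add_class free_pairs_zero)

lemma tensor_add_zero_right: "s \<in> tensor_carrier A B \<Longrightarrow> tensor_add A B s (tensor_zero A B) = s"
  unfolding tensor_zero_def by (auto elim!: tensor_carrierE simp: tensor_add_class free_pairs_zero)

lemma clinear_between_tensor_map:
  assumes "clinear_between A C \<phi>" "clinear_between B D \<psi>"
  shows "clinear_between (schur_alg A B) (schur_alg C D) (tensor_map C D \<phi> \<psi>)"
proof -
  have fm: "free_map \<phi> \<psi> f \<in> free_pairs C D" if "f \<in> free_pairs A B" for f
    using free_map_tensor_rel[OF assms, of f f] that by (simp add: tensor_rel_def free.span_zero)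
  note cls = tensor_map_class[OF assms] tensor_add_class tensor_scale_class fm
    free_pairs_add free_pairs_scale free_map_add free_map_scale
  show ?thesis
    unfolding clinear_between_def
    by (auto simp: schur_alg_def cls elim!: tensor_carrierE intro!: tensor_class_carrier)
qed

section \<open>Schur decompositions\<close>

text \<open>
  A representative of \<open>\<alpha>(x \<circ> y)\<beta>\<close> in the free vector space, where the finite sums can be rearranged
  freely; two representatives are then compared modulo the bilinearity relations.
\<close>

definition free_sandwich ::
  "nat \<Rightarrow> (nat \<Rightarrow> nat \<Rightarrow> complex) \<Rightarrow> (nat \<Rightarrow> nat \<Rightarrow> 'a) \<Rightarrow> (nat \<Rightarrow> nat \<Rightarrow> 'b) \<Rightarrow> (nat \<Rightarrow> nat \<Rightarrow> complex) \<Rightarrow>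
    nat \<Rightarrow> nat \<Rightarrow> ('a \<times> 'b \<Rightarrow>\<^sub>0 complex)" where
  "free_sandwich n \<alpha> x y \<beta> i j =
     (\<Sum>k<n. \<Sum>l<n. free_scale (\<alpha> i k * \<beta> l j) (fgen (x k l) (y k l)))"

lemma free_sandwich_free_pairs:
  "x \<in> mats n A \<Longrightarrow> y \<in> mats n B \<Longrightarrow> free_sandwich n \<alpha> x y \<beta> i j \<in> free_pairs A B"
  unfolding free_sandwich_def
  by (intro free_pairs_sum free_pairs_scale fgen_free_pairs) (auto simp: mats_def)

lemma msum_cong: "(\<And>k. k < n \<Longrightarrow> f k = g k) \<Longrightarrow> msum A n f = msum A n g"
  by (induction n) auto

lemma msum_tensor_class:
  "(\<And>k. k < n \<Longrightarrow> f k \<in> free_pairs A B) \<Longrightarrow>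
    msum (tensor_vs A B) n (\<lambda>k. tensor_class A B (f k)) = tensor_class A B (\<Sum>k<n. f k)"
proof (induction n)
  case 0
  then show ?case by (simp add: tensor_vs_def tensor_zero_def)
next
  case (Suc n)
  then have "msum (tensor_vs A B) n (\<lambda>k. tensor_class A B (f k)) = tensor_class A B (\<Sum>k<n. f k)"
    by simp
  moreover have "(\<Sum>k<n. f k) \<in> free_pairs A B" "f n \<in> free_pairs A B"
    using Suc.prems by (auto intro: free_pairs_sum)
  ultimately show ?case by (simp add: tensor_vs_def tensor_add_class)
qed

lemma sandwich_circ_prod:
  assumes x: "x \<in> mats n A" and y: "y \<in> mats n B"
  shows "sandwich (tensor_vs A B) n \<alpha> (circ_prod A B x y) \<beta> i j
    = tensor_class A B (free_sandwich n \<alpha> x y \<beta> i j)"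
proof -
  have gen: "fgen (x k l) (y k l) \<in> free_pairs A B" if "k < n" "l < n" for k l
    using that x y by (intro fgen_free_pairs) (auto simp: mats_def)
  let ?t = "\<lambda>k l. free_scale (\<alpha> i k * \<beta> l j) (fgen (x k l) (y k l))"
  have "sandwich (tensor_vs A B) n \<alpha> (circ_prod A B x y) \<beta> i j
      = msum (tensor_vs A B) n (\<lambda>k. msum (tensor_vs A B) n (\<lambda>l. tensor_class A B (?t k l)))"
    unfolding sandwich_def circ_prod_def elem_tensor_def
    by (intro msum_cong) (simp add: tensor_vs_def tensor_scale_class gen)
  also have "\<dots> = msum (tensor_vs A B) n (\<lambda>k. tensor_class A B (\<Sum>l<n. ?t k l))"
    by (intro msum_cong msum_tensor_class free_pairs_scale gen)
  also have "\<dots> = tensor_class A B (free_sandwich n \<alpha> x y \<beta> i j)"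
    unfolding free_sandwich_def
    by (intro msum_tensor_class free_pairs_sum free_pairs_scale gen) auto
  finally show ?thesis .
qed

text \<open>
  The normal form of a decomposition: \<open>x\<close> and \<open>y\<close> are contractions, and the remaining size is shared
  equally by \<open>\<alpha>\<close> and \<open>\<beta>\<close>. Bounding the squares makes \<open>M\<close> additive under direct sums.
\<close>

definition schur_decomp ::
  "'a mspace \<Rightarrow> 'b mspace \<Rightarrow> nat \<Rightarrow> (nat \<Rightarrow> nat \<Rightarrow> ('a, 'b) tensor) \<Rightarrow> real \<Rightarrow> bool" where
  "schur_decomp A B p u M \<longleftrightarrow>
     (\<exists>n \<alpha> x y \<beta>. 1 \<le> n \<and> x \<in> mats n A \<and> y \<in> mats n B \<and> mnorm A n x \<le> 1 \<and> mnorm B n y \<le> 1 \<and>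
        (cmat_norm p n \<alpha>)\<^sup>2 \<le> M \<and> (cmat_norm n p \<beta>)\<^sup>2 \<le> M \<and>
        (\<forall>i<p. \<forall>j<p. u i j = tensor_class A B (free_sandwich n \<alpha> x y \<beta> i j)))"

lemma schur_decompE:
  assumes "schur_decomp A B p u M"
  obtains n \<alpha> x y \<beta> where "1 \<le> n" "x \<in> mats n A" "y \<in> mats n B" "mnorm A n x \<le> 1" "mnorm B n y \<le> 1"
    "(cmat_norm p n \<alpha>)\<^sup>2 \<le> M" "(cmat_norm n p \<beta>)\<^sup>2 \<le> M"
    "\<And>i j. i < p \<Longrightarrow> j < p \<Longrightarrow> u i j = tensor_class A B (free_sandwich n \<alpha> x y \<beta> i j)"
  using assms unfolding schur_decomp_def by blast

lemma schur_decompI: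
  assumes "1 \<le> n" "x \<in> mats n A" "y \<in> mats n B" "mnorm A n x \<le> 1" "mnorm B n y \<le> 1"
    "(cmat_norm p n \<alpha>)\<^sup>2 \<le> M" "(cmat_norm n p \<beta>)\<^sup>2 \<le> M"
    "\<And>i j. i < p \<Longrightarrow> j < p \<Longrightarrow> u i j = tensor_class A B (free_sandwich n \<alpha> x y \<beta> i j)"
  shows "schur_decomp A B p u M"
  using assms unfolding schur_decomp_def by blast

text \<open>
  Since \<open>\<phi> \<otimes> \<psi>\<close> is linear, it commutes with the scalar matrices and sends \<open>x \<circ> y\<close> to
  \<open>\<phi>(x) \<circ> \<psi>(y)\<close>, where \<open>\<phi>(x)\<close> and \<open>\<psi>(y)\<close> are again contractions.
\<close>

lemma schur_decomp_tensor_map: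
  assumes \<phi>: "clinear_between A C \<phi>" and \<psi>: "clinear_between B D \<psi>"
    and \<phi>1: "\<And>n x. 1 \<le> n \<Longrightarrow> x \<in> mats n A \<Longrightarrow> mnorm A n x \<le> 1 \<Longrightarrow> mnorm C n (\<lambda>i j. \<phi> (x i j)) \<le> 1"
    and \<psi>1: "\<And>n y. 1 \<le> n \<Longrightarrow> y \<in> mats n B \<Longrightarrow> mnorm B n y \<le> 1 \<Longrightarrow> mnorm D n (\<lambda>i j. \<psi> (y i j)) \<le> 1"
    and u: "schur_decomp A B p u M"
  shows "schur_decomp C D p (\<lambda>i j. tensor_map C D \<phi> \<psi> (u i j)) M"
proof -
  obtain n \<alpha> x y \<beta> where d: "1 \<le> n" "x \<in> mats n A" "y \<in> mats n B" "mnorm A n x \<le> 1" "mnorm B n y \<le> 1"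
    "(cmat_norm p n \<alpha>)\<^sup>2 \<le> M" "(cmat_norm n p \<beta>)\<^sup>2 \<le> M"
    and ueq: "\<And>i j. i < p \<Longrightarrow> j < p \<Longrightarrow> u i j = tensor_class A B (free_sandwich n \<alpha> x y \<beta> i j)"
    by (rule schur_decompE[OF u]) blast
  have fm0: "free_map \<phi> \<psi> 0 = 0" by (simp add: free_map_def)
  have fm_sum: "free_map \<phi> \<psi> (\<Sum>k<m. g k) = (\<Sum>k<m. free_map \<phi> \<psi> (g k))" for m :: nat and g
    by (induction m) (simp_all add: fm0 free_map_add)
  show ?thesis
  proof (rule schur_decompI[OF d(1) _ _ \<phi>1[OF d(1,2,4)] \<psi>1[OF d(1,3,5)] d(6,7)])
    show "(\<lambda>i j. \<phi> (x i j)) \<in> mats n C" "(\<lambda>i j. \<psi> (y i j)) \<in> mats n D"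
      using d(2,3) \<phi> \<psi> by (auto simp: mats_def clinear_between_def)
    fix i j assume "i < p" "j < p"
    then have "tensor_map C D \<phi> \<psi> (u i j)
        = tensor_class C D (free_map \<phi> \<psi> (free_sandwich n \<alpha> x y \<beta> i j))"
      using tensor_map_class[OF \<phi> \<psi> free_sandwich_free_pairs[OF d(2,3)]] by (simp add: ueq)
    also have "free_map \<phi> \<psi> (free_sandwich n \<alpha> x y \<beta> i j)
        = free_sandwich n \<alpha> (\<lambda>i j. \<phi> (x i j)) (\<lambda>i j. \<psi> (y i j)) \<beta> i j"
      by (simp add: free_sandwich_def fm_sum free_map_scale)
    finally show "tensor_map C D \<phi> \<psi> (u i j)
        = tensor_class C D (free_sandwich n \<alpha> (\<lambda>i j. \<phi> (x i j)) (\<lambda>i j. \<psi> (y i j)) \<beta> i j)" .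
  qed
qed

locale schur_pair = A: matricial_space A + B: matricial_space B
  for A :: "'a mspace" and B :: "'b mspace"
begin

lemma fgen_scale_scale:
  assumes "v \<in> carrier A" "w \<in> carrier B"
  shows "fgen (mscale A r v) (mscale B q w) - free_scale (r * q) (fgen v w) \<in> relator_span A B"
proof -
  have "fgen (mscale A r v) (mscale B q w) - free_scale r (fgen v (mscale B q w)) \<in> bilin_relators A B"
    using assms B.scale_closed unfolding bilin_relators_def by blast
  moreover have "fgen v (mscale B q w) - free_scale q (fgen v w) \<in> bilin_relators A B"
    using assms unfolding bilin_relators_def by blast
  ultimately have "(fgen (mscale A r v) (mscale B q w) - free_scale r (fgen v (mscale B q w)))
      + free_scale r (fgen v (mscale B q w) - free_scale q (fgen v w)) \<in> relator_span A B"
    by (intro free.span_add free.span_scale free.span_base)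
  then show ?thesis by (simp add: free.scale_right_diff_distrib)
qed

lemma fgen_zero_zero: "fgen (mzero A) (mzero B) \<in> relator_span A B"
  using fgen_scale_scale[OF A.zero_closed B.zero_closed, of 0 0]
  by (simp add: A.scale_zero B.scale_zero A.zero_closed B.zero_closed)

text \<open>
  A product of four norms below \<open>M\<close> can be redistributed: \<open>x\<close> and \<open>y\<close> are divided by (slightly more than)
  their norms, and \<open>\<alpha>\<close> and \<open>\<beta>\<close> absorb these factors in the proportion that makes their norms equal. Since
  the inequality is strict, all four norms can first be replaced by slightly larger, hence positive,
  numbers, so that norms equal to zero need no separate treatment.
\<close>

lemma schur_decomp_normalize:
  assumes n: "1 \<le> n" and x: "x \<in> mats n A" and y: "y \<in> mats n B"
    and lt: "cmat_norm p n \<alpha> * mnorm A n x * mnorm B n y * cmat_norm n p \<beta> < M"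
    and u: "\<And>i j. i < p \<Longrightarrow> j < p \<Longrightarrow> u i j = tensor_class A B (free_sandwich n \<alpha> x y \<beta> i j)"
  shows "schur_decomp A B p u M"
proof -
  define f where "f d = (cmat_norm p n \<alpha> + d) * (mnorm A n x + d) * (mnorm B n y + d) * (cmat_norm n p \<beta> + d)"
    for d
  have "(f \<longlongrightarrow> f 0) (at_right 0)"
    unfolding f_def by (intro tendsto_intros)
  moreover have "f 0 < M" using lt by (simp add: f_def)
  ultimately have "eventually (\<lambda>d. f d < M) (at_right 0)"
    by (rule order_tendstoD)
  moreover have "eventually (\<lambda>d. d > (0::real)) (at_right 0)"
    by (rule eventually_at_right_less)
  ultimately have "eventually (\<lambda>d. f d < M \<and> d > 0) (at_right 0)"
    by (rule eventually_conj)
  from eventually_happens'[OF trivial_limit_at_right_real this]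
  obtain d where d: "f d < M" "d > 0" by blast
  define a b c e where "a = cmat_norm p n \<alpha> + d" and "b = mnorm A n x + d"
    and "c = mnorm B n y + d" and "e = cmat_norm n p \<beta> + d"
  have pos: "a > 0" "b > 0" "c > 0" "e > 0"
    using d(2) cmat_norm_nonneg A.mnorm_nonneg[OF x] B.mnorm_nonneg[OF y]
    by (simp_all add: a_def b_def c_def e_def add_nonneg_pos)
  have M: "a * b * c * e \<le> M"
    using d(1) by (simp add: f_def a_def b_def c_def e_def)
  \<comment> \<open>the positive solutions of \<open>s * t = b * c\<close> and \<open>s * a = t * e\<close>\<close>
  define s t where "s = sqrt (b * c * e / a)" and "t = sqrt (b * c * a / e)"
  have st: "s * t = b * c"
  proof -
    have "(b * c * e / a) * (b * c * a / e) = (b * c)\<^sup>2"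
      using pos by (simp add: power2_eq_square divide_simps)
    then have "s * t = sqrt ((b * c)\<^sup>2)"
      unfolding s_def t_def real_sqrt_mult[symmetric] by simp
    then show ?thesis using pos by simp
  qed
  have st0: "s > 0" "t > 0" using pos by (simp_all add: s_def t_def)
  let ?x = "\<lambda>i j. mscale A (complex_of_real (1 / b)) (x i j)"
    and ?y = "\<lambda>i j. mscale B (complex_of_real (1 / c)) (y i j)"
    and ?\<alpha> = "\<lambda>i j. complex_of_real s * \<alpha> i j" and ?\<beta> = "\<lambda>i j. complex_of_real t * \<beta> i j"
  show ?thesis
  proof (rule schur_decompI[OF n A.scale_mats[OF x] B.scale_mats[OF y]])
    have "mnorm A n ?x \<le> cmod (complex_of_real (1 / b)) * mnorm A n x"
      by (rule A.mnorm_scale_le[OF x])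
    also have "\<dots> \<le> 1" using pos d(2) by (simp add: norm_divide) (simp add: b_def)
    finally show "mnorm A n ?x \<le> 1" .
    have "mnorm B n ?y \<le> cmod (complex_of_real (1 / c)) * mnorm B n y"
      by (rule B.mnorm_scale_le[OF y])
    also have "\<dots> \<le> 1" using pos d(2) by (simp add: norm_divide) (simp add: c_def)
    finally show "mnorm B n ?y \<le> 1" .
    have "cmat_norm p n ?\<alpha> \<le> s * a"
      by (rule order_trans[OF cmat_norm_scale_le]) (use st0 d(2) in \<open>simp add: a_def\<close>)
    then have "(cmat_norm p n ?\<alpha>)\<^sup>2 \<le> (s * a)\<^sup>2"
      by (intro power_mono cmat_norm_nonneg)
    also have "\<dots> = (b * c * e / a) * a\<^sup>2"
      unfolding power_mult_distrib s_def using pos by (subst real_sqrt_pow2) auto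
    also have "\<dots> = a * b * c * e"
      using pos by (simp add: power2_eq_square)
    finally show "(cmat_norm p n ?\<alpha>)\<^sup>2 \<le> M" using M by simp
    have "cmat_norm n p ?\<beta> \<le> t * e"
      by (rule order_trans[OF cmat_norm_scale_le]) (use st0 d(2) in \<open>simp add: e_def\<close>)
    then have "(cmat_norm n p ?\<beta>)\<^sup>2 \<le> (t * e)\<^sup>2"
      by (intro power_mono cmat_norm_nonneg)
    also have "\<dots> = (b * c * a / e) * e\<^sup>2"
      unfolding power_mult_distrib t_def using pos by (subst real_sqrt_pow2) auto
    also have "\<dots> = a * b * c * e"
      using pos by (simp add: power2_eq_square)
    finally show "(cmat_norm n p ?\<beta>)\<^sup>2 \<le> M" using M by simp
    fix i j assume ij: "i < p" "j < p"
    have coeff: "complex_of_real s * complex_of_real t * (complex_of_real (1 / b) * complex_of_real (1 / c)) = 1"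
      unfolding of_real_mult[symmetric] st using pos by simp
    have "free_sandwich n \<alpha> x y \<beta> i j - free_sandwich n ?\<alpha> ?x ?y ?\<beta> i j
        = - (\<Sum>k<n. \<Sum>l<n. free_scale (?\<alpha> i k * ?\<beta> l j)
            (fgen (?x k l) (?y k l)
              - free_scale (complex_of_real (1 / b) * complex_of_real (1 / c)) (fgen (x k l) (y k l))))"
    proof -
      have "?\<alpha> i k * ?\<beta> l j * (complex_of_real (1 / b) * complex_of_real (1 / c)) = \<alpha> i k * \<beta> l j" for k l
      proof -
        have "?\<alpha> i k * ?\<beta> l j * (complex_of_real (1 / b) * complex_of_real (1 / c))
            = complex_of_real s * complex_of_real t * (complex_of_real (1 / b) * complex_of_real (1 / c))
              * (\<alpha> i k * \<beta> l j)"
          by (simp only: mult_ac)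
        then show ?thesis by (simp only: coeff mult_1_left)
      qed
      then show ?thesis
        unfolding free_sandwich_def
        by (simp only: free.scale_right_diff_distrib free.scale_scale sum_subtractf minus_diff_eq)
    qed
    also have "\<dots> \<in> relator_span A B"
      using x y by (intro free.span_neg free.span_sum free.span_scale fgen_scale_scale) (auto simp: mats_def)
    finally show "u i j = tensor_class A B (free_sandwich n ?\<alpha> ?x ?y ?\<beta> i j)"
      unfolding u[OF ij]
      by (intro tensor_class_eqI free_sandwich_free_pairs x y A.scale_mats B.scale_mats)
  qed
qed

text \<open>
  The off-diagonal blocks of \<open>(x \<oplus> x') \<circ> (y \<oplus> y')\<close> consist of copies of \<open>0 \<otimes> 0\<close>, which vanishes in the
  tensor product but not in the free space.
\<close>

lemma free_sandwich_direct_sum: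
  fixes m n \<alpha> \<alpha>' \<beta> \<beta>'
  defines "\<gamma> \<equiv> (\<lambda>i k. if k < m then \<alpha> i k else \<alpha>' i (k - m))"
    and "\<delta> \<equiv> (\<lambda>k j. if k < m then \<beta> k j else \<beta>' (k - m) j)"
  shows "free_sandwich (m + n) \<gamma> (direct_sum A m x x') (direct_sum B m y y') \<delta> i j
    - (free_sandwich m \<alpha> x y \<beta> i j + free_sandwich n \<alpha>' x' y' \<beta>' i j) \<in> relator_span A B"
proof -
  let ?z = "fgen (mzero A) (mzero B)"
  have "free_sandwich (m + n) \<gamma> (direct_sum A m x x') (direct_sum B m y y') \<delta> i j
    - (free_sandwich m \<alpha> x y \<beta> i j + free_sandwich n \<alpha>' x' y' \<beta>' i j)
    = (\<Sum>k<m. \<Sum>l<n. free_scale (\<alpha> i k * \<beta>' l j) ?z) + (\<Sum>k<n. \<Sum>l<m. free_scale (\<alpha>' i k * \<beta> l j) ?z)"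
    by (simp add: free_sandwich_def sum_lessThan_add sum.distrib direct_sum_def \<gamma>_def \<delta>_def)
  also have "\<dots> \<in> relator_span A B"
    by (intro free.span_add free.span_sum free.span_scale fgen_zero_zero)
  finally show ?thesis .
qed

lemma schur_decomp_add:
  assumes u: "schur_decomp A B p u M" and v: "schur_decomp A B p v N"
  shows "schur_decomp A B p (\<lambda>i j. tensor_add A B (u i j) (v i j)) (M + N)"
proof -
  obtain m \<alpha> x y \<beta> where d: "1 \<le> m" "x \<in> mats m A" "y \<in> mats m B" "mnorm A m x \<le> 1" "mnorm B m y \<le> 1"
    "(cmat_norm p m \<alpha>)\<^sup>2 \<le> M" "(cmat_norm m p \<beta>)\<^sup>2 \<le> M"
    and ueq: "\<And>i j. i < p \<Longrightarrow> j < p \<Longrightarrow> u i j = tensor_class A B (free_sandwich m \<alpha> x y \<beta> i j)"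
    by (rule schur_decompE[OF u]) blast
  obtain n \<alpha>' x' y' \<beta>' where d': "1 \<le> n" "x' \<in> mats n A" "y' \<in> mats n B" "mnorm A n x' \<le> 1"
    "mnorm B n y' \<le> 1" "(cmat_norm p n \<alpha>')\<^sup>2 \<le> N" "(cmat_norm n p \<beta>')\<^sup>2 \<le> N"
    and veq: "\<And>i j. i < p \<Longrightarrow> j < p \<Longrightarrow> v i j = tensor_class A B (free_sandwich n \<alpha>' x' y' \<beta>' i j)"
    by (rule schur_decompE[OF v]) blast
  show ?thesis
  proof (rule schur_decompI)
    show "1 \<le> m + n" using d(1) by simp
    show xs: "direct_sum A m x x' \<in> mats (m + n) A" by (rule A.direct_sum_mats[OF d(2) d'(2)])
    show ys: "direct_sum B m y y' \<in> mats (m + n) B" by (rule B.direct_sum_mats[OF d(3) d'(3)])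
    show "mnorm A (m + n) (direct_sum A m x x') \<le> 1"
      using A.mnorm_direct_sum_le[OF d(2) d'(2)] d(4) d'(4) by simp
    show "mnorm B (m + n) (direct_sum B m y y') \<le> 1"
      using B.mnorm_direct_sum_le[OF d(3) d'(3)] d(5) d'(5) by simp
    show "(cmat_norm p (m + n) (\<lambda>i k. if k < m then \<alpha> i k else \<alpha>' i (k - m)))\<^sup>2 \<le> M + N"
      by (rule cmat_norm_row_power2_le[OF d(6) d'(6)])
    show "(cmat_norm (m + n) p (\<lambda>k j. if k < m then \<beta> k j else \<beta>' (k - m) j))\<^sup>2 \<le> M + N"
      by (rule cmat_norm_column_power2_le[OF d(7) d'(7)])
    fix i j assume ij: "i < p" "j < p"
    show "tensor_add A B (u i j) (v i j) = tensor_class A B (free_sandwich (m + n)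
        (\<lambda>i k. if k < m then \<alpha> i k else \<alpha>' i (k - m)) (direct_sum A m x x') (direct_sum B m y y')
        (\<lambda>k j. if k < m then \<beta> k j else \<beta>' (k - m) j) i j)"
      unfolding ueq[OF ij] veq[OF ij]
        tensor_add_class[OF free_sandwich_free_pairs[OF d(2,3)] free_sandwich_free_pairs[OF d'(2,3)]]
      by (rule sym, rule tensor_class_eqI[OF free_sandwich_free_pairs[OF xs ys] _ free_sandwich_direct_sum])
        (intro free_pairs_add free_sandwich_free_pairs d(2,3) d'(2,3))
  qed
qed

text \<open>
  The scalar is split as \<open>\<surd>c \<cdot> \<surd>c\<close> between \<open>\<alpha>\<close> and \<open>\<beta>\<close>, because both have to satisfy the same bound.
\<close>

lemma schur_decomp_scale:
  assumes u: "schur_decomp A B p u M"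
  shows "schur_decomp A B p (\<lambda>i j. tensor_scale A B c (u i j)) (cmod c * M)"
proof -
  obtain n \<alpha> x y \<beta> where d: "1 \<le> n" "x \<in> mats n A" "y \<in> mats n B" "mnorm A n x \<le> 1" "mnorm B n y \<le> 1"
    "(cmat_norm p n \<alpha>)\<^sup>2 \<le> M" "(cmat_norm n p \<beta>)\<^sup>2 \<le> M"
    and ueq: "\<And>i j. i < p \<Longrightarrow> j < p \<Longrightarrow> u i j = tensor_class A B (free_sandwich n \<alpha> x y \<beta> i j)"
    by (rule schur_decompE[OF u]) blast
  let ?r = "csqrt c"
  have r: "(cmod ?r)\<^sup>2 = cmod c" by (metis norm_power power2_csqrt)
  have *: "(cmat_norm k l (\<lambda>i j. ?r * \<gamma> i j))\<^sup>2 \<le> cmod c * M" if "(cmat_norm k l \<gamma>)\<^sup>2 \<le> M" for k l \<gamma>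
  proof -
    have "(cmat_norm k l (\<lambda>i j. ?r * \<gamma> i j))\<^sup>2 \<le> (cmod ?r * cmat_norm k l \<gamma>)\<^sup>2"
      by (intro power_mono cmat_norm_scale_le cmat_norm_nonneg)
    also have "\<dots> \<le> cmod c * M"
      using that by (simp add: power_mult_distrib r mult_left_mono)
    finally show ?thesis .
  qed
  show ?thesis
  proof (rule schur_decompI[OF d(1-5) *[OF d(6)] *[OF d(7)]])
    fix i j assume "i < p" "j < p"
    have "?r * \<alpha> i k * (?r * \<beta> l j) = ?r\<^sup>2 * (\<alpha> i k * \<beta> l j)" for k l
      by (simp only: power2_eq_square mult_ac)
    then have coeff: "?r * \<alpha> i k * (?r * \<beta> l j) = c * (\<alpha> i k * \<beta> l j)" for k l
      by (simp only: power2_csqrt)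
    have "free_scale c (free_sandwich n \<alpha> x y \<beta> i j)
        = free_sandwich n (\<lambda>i j. ?r * \<alpha> i j) x y (\<lambda>i j. ?r * \<beta> i j) i j"
      by (simp only: free_sandwich_def free.scale_sum_right free.scale_scale coeff)
    then show "tensor_scale A B c (u i j)
        = tensor_class A B (free_sandwich n (\<lambda>i j. ?r * \<alpha> i j) x y (\<lambda>i j. ?r * \<beta> i j) i j)"
      using \<open>i < p\<close> \<open>j < p\<close> by (simp add: ueq tensor_scale_class free_sandwich_free_pairs[OF d(2,3)])
  qed
qed

lemma schur_decomp_zero: "schur_decomp A B p (\<lambda>_ _. tensor_zero A B) 0"
proof (rule schur_decompI[where n = 1 and x = "\<lambda>_ _. mzero A" and y = "\<lambda>_ _. mzero B"
      and \<alpha> = "\<lambda>_ _. 0" and \<beta> = "\<lambda>_ _. 0"])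
  have z: "(cmat_norm k l (\<lambda>_ _. 0))\<^sup>2 \<le> 0" for k l
    using cmat_norm_le[where K = 0 and n = l and p = k and \<alpha> = "\<lambda>_ _. 0"] cmat_norm_nonneg[of k l "\<lambda>_ _. 0"]
    by (simp add: L2_set_def)
  show "(cmat_norm p 1 (\<lambda>_ _. 0))\<^sup>2 \<le> 0" "(cmat_norm 1 p (\<lambda>_ _. 0))\<^sup>2 \<le> 0"
    by (rule z)+
  show "mnorm A 1 (\<lambda>_ _. mzero A) \<le> 1" "mnorm B 1 (\<lambda>_ _. mzero B) \<le> 1"
    using A.mnorm_zero_le[of 1] B.mnorm_zero_le[of 1] by linarith+
qed (simp_all add: mats_def A.zero_closed B.zero_closed tensor_zero_def free_sandwich_def)

text \<open>
  The row of \<open>\<alpha>\<close> is moved to position \<open>i0\<close> and the column of \<open>\<beta>\<close> to position \<open>j0\<close>, with zeros elsewhere.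
\<close>

lemma schur_decomp_single_entry:
  assumes t: "schur_decomp A B 1 (\<lambda>_ _. t) M"
  shows "schur_decomp A B p (\<lambda>i j. if i = i0 \<and> j = j0 then t else tensor_zero A B) M"
proof -
  obtain n \<alpha> x y \<beta> where d: "1 \<le> n" "x \<in> mats n A" "y \<in> mats n B" "mnorm A n x \<le> 1" "mnorm B n y \<le> 1"
    "(cmat_norm 1 n \<alpha>)\<^sup>2 \<le> M" "(cmat_norm n 1 \<beta>)\<^sup>2 \<le> M"
    and teq: "t = tensor_class A B (free_sandwich n \<alpha> x y \<beta> 0 0)"
    by (rule schur_decompE[OF t]) auto
  show ?thesis
  proof (rule schur_decompI[OF d(1-5)])
    show "(cmat_norm p n (\<lambda>i k. if i = i0 then \<alpha> 0 k else 0))\<^sup>2 \<le> M"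
      by (rule order_trans[OF power_mono[OF cmat_norm_single_row_le cmat_norm_nonneg] d(6)])
    show "(cmat_norm n p (\<lambda>k j. if j = j0 then \<beta> k 0 else 0))\<^sup>2 \<le> M"
      by (rule order_trans[OF power_mono[OF cmat_norm_single_column_le cmat_norm_nonneg] d(7)])
    fix i j
    show "(if i = i0 \<and> j = j0 then t else tensor_zero A B) = tensor_class A B
      (free_sandwich n (\<lambda>i k. if i = i0 then \<alpha> 0 k else 0) x y (\<lambda>k j. if j = j0 then \<beta> k 0 else 0) i j)"
      by (auto simp: teq free_sandwich_def tensor_zero_def)
  qed
qed

text \<open>
  A matrix is the sum of the matrices that contain just one of its entries.
\<close>

lemma schur_decomp_entries:
  assumes u: "\<And>i j. i < p \<Longrightarrow> j < p \<Longrightarrow> u i j \<in> tensor_carrier A B"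
    and M: "\<And>i j. i < p \<Longrightarrow> j < p \<Longrightarrow> schur_decomp A B 1 (\<lambda>_ _. u i j) (M i j)"
  shows "schur_decomp A B p u (\<Sum>i<p. \<Sum>j<p. M i j)"
proof -
  have partial: "schur_decomp A B p (\<lambda>i j. if (i, j) \<in> P then u i j else tensor_zero A B)
      (\<Sum>(i, j)\<in>P. M i j)" if "finite P" "P \<subseteq> {..<p} \<times> {..<p}" for P
    using that
  proof (induction P)
    case empty
    then show ?case using schur_decomp_zero by simp
  next
    case (insert q P)
    obtain i0 j0 where q: "q = (i0, j0)" by (cases q)
    then have ij: "i0 < p" "j0 < p" using insert.prems by auto
    have "schur_decomp A B p (\<lambda>i j. tensor_add A B
        (if i = i0 \<and> j = j0 then u i0 j0 else tensor_zero A B)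
        (if (i, j) \<in> P then u i j else tensor_zero A B)) (M i0 j0 + (\<Sum>(i, j)\<in>P. M i j))"
      using insert by (intro schur_decomp_add schur_decomp_single_entry M ij) auto
    also have "(\<lambda>i j. tensor_add A B
        (if i = i0 \<and> j = j0 then u i0 j0 else tensor_zero A B)
        (if (i, j) \<in> P then u i j else tensor_zero A B))
      = (\<lambda>i j. if (i, j) \<in> insert q P then u i j else tensor_zero A B)"
      using insert.hyps insert.prems u
      by (intro ext) (auto simp: q tensor_add_zero_left tensor_add_zero_right tensor_zero_carrier)
    finally show ?case using insert.hyps by (simp add: q)
  qed
  have "schur_decomp A B p (\<lambda>i j. if (i, j) \<in> {..<p} \<times> {..<p} then u i j else tensor_zero A B)
      (\<Sum>i<p. \<Sum>j<p. M i j)"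
    using partial[of "{..<p} \<times> {..<p}"] by (simp only: sum.cartesian_product) simp
  then show ?thesis unfolding schur_decomp_def by simp
qed

text \<open>
  An elementary tensor is a decomposition of size one, and every tensor is a finite sum of multiples of
  elementary tensors.
\<close>

lemma schur_decomp_exists_class:
  assumes "f \<in> free_pairs A B"
  shows "\<exists>M. schur_decomp A B 1 (\<lambda>_ _. tensor_class A B f) M"
proof -
  have gen: "free_scale c (fgen v w) \<in> free_pairs A B \<and>
      (\<exists>M. schur_decomp A B 1 (\<lambda>_ _. tensor_class A B (free_scale c (fgen v w))) M)"
    if "v \<in> carrier A" "w \<in> carrier B" for c v w
  proof
    show "free_scale c (fgen v w) \<in> free_pairs A B"
      using that by (intro free_pairs_scale fgen_free_pairs)
    show "\<exists>M. schur_decomp A B 1 (\<lambda>_ _. tensor_class A B (free_scale c (fgen v w))) M"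
    proof (rule exI, rule schur_decomp_normalize[OF _ _ _ less_add_one])
      show "(1::nat) \<le> 1" ..
      show "(\<lambda>_ _. v) \<in> mats 1 A" "(\<lambda>_ _. w) \<in> mats 1 B"
        using that by (simp_all add: mats_def)
      show "tensor_class A B (free_scale c (fgen v w))
          = tensor_class A B (free_sandwich 1 (\<lambda>_ _. c) (\<lambda>_ _. v) (\<lambda>_ _. w) (\<lambda>_ _. 1) i j)" for i j :: nat
        by (simp add: free_sandwich_def)
    qed
  qed
  have partial: "(\<Sum>k\<in>K. free_scale (Poly_Mapping.lookup f k) (fgen (fst k) (snd k))) \<in> free_pairs A B \<and>
    (\<exists>M. schur_decomp A B 1 (\<lambda>_ _. tensor_class A B
      (\<Sum>k\<in>K. free_scale (Poly_Mapping.lookup f k) (fgen (fst k) (snd k)))) M)"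
    if "finite K" "K \<subseteq> carrier A \<times> carrier B" for K
    using that
  proof (induction K)
    case empty
    then show ?case using schur_decomp_zero[of 1] free_pairs_zero by (auto simp: tensor_zero_def)
  next
    case (insert k K)
    let ?t = "free_scale (Poly_Mapping.lookup f k) (fgen (fst k) (snd k))"
    let ?s = "\<Sum>k\<in>K. free_scale (Poly_Mapping.lookup f k) (fgen (fst k) (snd k))"
    have t: "?t \<in> free_pairs A B" "\<exists>M. schur_decomp A B 1 (\<lambda>_ _. tensor_class A B ?t) M"
      using gen insert.prems by auto
    have s: "?s \<in> free_pairs A B" "\<exists>M. schur_decomp A B 1 (\<lambda>_ _. tensor_class A B ?s) M"
      using insert by auto
    obtain M N where "schur_decomp A B 1 (\<lambda>_ _. tensor_class A B ?t) M"
      "schur_decomp A B 1 (\<lambda>_ _. tensor_class A B ?s) N"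
      using s t by blast
    then have "schur_decomp A B 1
        (\<lambda>_ _. tensor_add A B (tensor_class A B ?t) (tensor_class A B ?s)) (M + N)"
      by (rule schur_decomp_add)
    then have "schur_decomp A B 1 (\<lambda>_ _. tensor_class A B (?t + ?s)) (M + N)"
      unfolding tensor_add_class[OF t(1) s(1)] .
    then show ?case using insert.hyps free_pairs_add[OF t(1) s(1)] by auto
  qed
  have expand: "f = (\<Sum>k\<in>Poly_Mapping.keys f. free_scale (Poly_Mapping.lookup f k) (fgen (fst k) (snd k)))"
  proof -
    have "free_map (\<lambda>v. v) (\<lambda>w. w) f
        = (\<Sum>k\<in>Poly_Mapping.keys f. free_scale (Poly_Mapping.lookup f k) (fgen (fst k) (snd k)))"
      unfolding free_map_def
      by (intro sum.cong refl poly_mapping_eqI) (simp add: lookup_single when_def)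
    moreover have "free_map (\<lambda>v. v) (\<lambda>w. w) f = f"
      by (rule poly_mapping_eqI)
        (simp add: free_map_def lookup_sum lookup_single when_def in_keys_iff)
    ultimately show ?thesis by simp
  qed
  have "Poly_Mapping.keys f \<subseteq> carrier A \<times> carrier B"
    using assms by (simp add: free_pairs_def)
  from partial[OF finite_keys this] show ?thesis
    unfolding expand[symmetric] by (rule conjunct2)
qed

lemma schur_decomp_exists:
  assumes "u \<in> mats p (schur_alg A B)"
  shows "\<exists>M. schur_decomp A B p u M"
proof -
  have u: "u i j \<in> tensor_carrier A B" if "i < p" "j < p" for i j
    using assms that by (simp add: mats_def schur_alg_def)
  have "\<exists>M. schur_decomp A B 1 (\<lambda>_ _. u i j) M" if "i < p" "j < p" for i j
    using u[OF that] schur_decomp_exists_class by (auto elim!: tensor_carrierE)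
  then obtain M where "\<And>i j. i < p \<Longrightarrow> j < p \<Longrightarrow> schur_decomp A B 1 (\<lambda>_ _. u i j) (M i j)"
    by metis
  then show ?thesis using schur_decomp_entries[where p = p and u = u and M = M, OF u] by blast
qed

section \<open>The Schur norm\<close>

text \<open>
  The set whose infimum is the Schur norm. The infimum of the empty set of reals is an unspecified number,
  so the existence of decompositions is essential for every lower bound on the norm.
\<close>

definition schur_values :: "nat \<Rightarrow> (nat \<Rightarrow> nat \<Rightarrow> ('a, 'b) tensor) \<Rightarrow> real set" where
  "schur_values p u =
     {cmat_norm p n \<alpha> * mnorm A n x * mnorm B n y * cmat_norm n p \<beta> |n \<alpha> x y \<beta>.
        1 \<le> n \<and> x \<in> mats n A \<and> y \<in> mats n B \<and>
        (\<forall>i<p. \<forall>j<p. u i j = sandwich (tensor_vs A B) n \<alpha> (circ_prod A B x y) \<beta> i j)}"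

lemma schur_norm_eq: "schur_norm A B p u = Inf (schur_values p u)"
  by (simp add: schur_norm_def schur_values_def)

lemma schur_values_nonneg: "r \<in> schur_values p u \<Longrightarrow> 0 \<le> r"
  by (auto simp: schur_values_def intro!: mult_nonneg_nonneg cmat_norm_nonneg A.mnorm_nonneg B.mnorm_nonneg)

lemma schur_decomp_value:
  assumes "schur_decomp A B p u M"
  shows "\<exists>r\<in>schur_values p u. r \<le> M"
proof -
  obtain n \<alpha> x y \<beta> where d: "1 \<le> n" "x \<in> mats n A" "y \<in> mats n B" "mnorm A n x \<le> 1" "mnorm B n y \<le> 1"
    "(cmat_norm p n \<alpha>)\<^sup>2 \<le> M" "(cmat_norm n p \<beta>)\<^sup>2 \<le> M"
    and ueq: "\<And>i j. i < p \<Longrightarrow> j < p \<Longrightarrow> u i j = tensor_class A B (free_sandwich n \<alpha> x y \<beta> i j)"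
    by (rule schur_decompE[OF assms]) blast
  have M: "M \<ge> 0" by (rule order_trans[OF zero_le_power2 d(6)])
  have ab: "cmat_norm p n \<alpha> \<le> sqrt M" "cmat_norm n p \<beta> \<le> sqrt M"
    using d(6,7) by (auto intro: real_le_rsqrt)
  let ?v = "cmat_norm p n \<alpha> * mnorm A n x * mnorm B n y * cmat_norm n p \<beta>"
  have "?v \<le> sqrt M * 1 * 1 * sqrt M"
    using M d(4,5) ab A.mnorm_nonneg[OF d(2)] B.mnorm_nonneg[OF d(3)]
    by (intro mult_mono mult_nonneg_nonneg cmat_norm_nonneg) auto
  then have "?v \<le> M" using M by simp
  moreover have "?v \<in> schur_values p u"
    unfolding schur_values_def
    by (intro CollectI exI conjI refl) (use d(1-3) ueq sandwich_circ_prod[OF d(2,3)] in auto)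
  ultimately show ?thesis by blast
qed

text \<open>
  Together with its converse \<open>schur_decomp_of_norm_less\<close>, this replaces the Schur norm by normal forms of
  decompositions in all later arguments.
\<close>

lemma schur_norm_le:
  assumes "schur_decomp A B p u M"
  shows "schur_norm A B p u \<le> M"
proof -
  obtain r where r: "r \<in> schur_values p u" "r \<le> M"
    using schur_decomp_value[OF assms] by blast
  have "Inf (schur_values p u) \<le> r"
    using r(1) schur_values_nonneg by (intro cInf_lower bdd_belowI[of _ 0])
  then show ?thesis using r(2) by (simp add: schur_norm_eq)
qed

lemma schur_decomp_of_norm_less:
  assumes u: "u \<in> mats p (schur_alg A B)" and M: "schur_norm A B p u < M"
  shows "schur_decomp A B p u M"
proof -
  have "schur_values p u \<noteq> {}"
    using schur_decomp_exists[OF u] schur_decomp_value by blast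
  then obtain r where "r \<in> schur_values p u" "r < M"
    using cInf_lessD M by (metis schur_norm_eq)
  then obtain n \<alpha> x y \<beta> where d: "1 \<le> n" "x \<in> mats n A" "y \<in> mats n B"
    "cmat_norm p n \<alpha> * mnorm A n x * mnorm B n y * cmat_norm n p \<beta> < M"
    "\<forall>i<p. \<forall>j<p. u i j = sandwich (tensor_vs A B) n \<alpha> (circ_prod A B x y) \<beta> i j"
    unfolding schur_values_def by blast
  show ?thesis
    using d(5) by (intro schur_decomp_normalize[OF d(1-4)]) (simp add: sandwich_circ_prod[OF d(2,3)])
qed

lemma schur_norm_nonneg:
  assumes "u \<in> mats p (schur_alg A B)"
  shows "0 \<le> schur_norm A B p u"
  unfolding schur_norm_eq
  using schur_decomp_exists[OF assms] schur_decomp_value schur_values_nonneg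
  by (intro cInf_greatest) blast+

lemma schur_norm_add_le:
  assumes u: "u \<in> mats p (schur_alg A B)" and v: "v \<in> mats p (schur_alg A B)"
  shows "schur_norm A B p (\<lambda>i j. tensor_add A B (u i j) (v i j)) \<le> schur_norm A B p u + schur_norm A B p v"
proof (rule field_le_epsilon)
  fix e :: real assume "e > 0"
  then have "schur_decomp A B p (\<lambda>i j. tensor_add A B (u i j) (v i j))
      ((schur_norm A B p u + e / 2) + (schur_norm A B p v + e / 2))"
    by (intro schur_decomp_add schur_decomp_of_norm_less u v) simp_all
  from schur_norm_le[OF this]
  show "schur_norm A B p (\<lambda>i j. tensor_add A B (u i j) (v i j))
      \<le> schur_norm A B p u + schur_norm A B p v + e" by simp
qed

lemma schur_norm_scale_le:
  assumes u: "u \<in> mats p (schur_alg A B)"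
  shows "schur_norm A B p (\<lambda>i j. tensor_scale A B c (u i j)) \<le> cmod c * schur_norm A B p u"
proof (rule tendsto_lowerbound)
  show "((\<lambda>e. cmod c * (schur_norm A B p u + e)) \<longlongrightarrow> cmod c * schur_norm A B p u) (at_right 0)"
    by (auto intro!: tendsto_eq_intros)
  show "\<forall>\<^sub>F e in at_right 0.
      schur_norm A B p (\<lambda>i j. tensor_scale A B c (u i j)) \<le> cmod c * (schur_norm A B p u + e)"
    using eventually_at_right_less[of 0]
    by eventually_elim (intro schur_norm_le schur_decomp_scale schur_decomp_of_norm_less u, simp)
qed simp

lemma schur_norm_le_sum_entries:
  assumes u: "u \<in> mats p (schur_alg A B)"
  shows "schur_norm A B p u \<le> (\<Sum>i<p. \<Sum>j<p. schur_norm A B 1 (\<lambda>_ _. u i j))"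
proof (rule tendsto_lowerbound)
  show "((\<lambda>e. \<Sum>i<p. \<Sum>j<p. schur_norm A B 1 (\<lambda>_ _. u i j) + e)
      \<longlongrightarrow> (\<Sum>i<p. \<Sum>j<p. schur_norm A B 1 (\<lambda>_ _. u i j))) (at_right 0)"
    by (auto intro!: tendsto_eq_intros)
  have carr: "u i j \<in> tensor_carrier A B" if "i < p" "j < p" for i j
    using u that by (simp add: mats_def schur_alg_def)
  show "\<forall>\<^sub>F e in at_right 0. schur_norm A B p u \<le> (\<Sum>i<p. \<Sum>j<p. schur_norm A B 1 (\<lambda>_ _. u i j) + e)"
    using eventually_at_right_less[of 0]
  proof eventually_elim
    case (elim e)
    then show ?case
      using carr
      by (intro schur_norm_le schur_decomp_entries schur_decomp_of_norm_less)
        (auto simp: mats_def schur_alg_def)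
  qed
qed simp

end

section \<open>Completion of matrix pseudometrics\<close>

lemma tendsto_null_dominated:
  fixes f g :: "'a \<Rightarrow> real"
  assumes "(g \<longlongrightarrow> 0) F" and "\<And>x. 0 \<le> f x" and "\<And>x. f x \<le> g x"
  shows "(f \<longlongrightarrow> 0) F"
  using assms by (intro tendsto_sandwich[of "\<lambda>_. 0" f F g] always_eventually) auto

text \<open>
  What the completion needs: the distance of the first matrix level is a pseudometric for which the
  algebraic operations are Lipschitz continuous, and it controls the variation of every matrix norm. The
  matrix norms of a sequence of matrices with Cauchy entries then converge, and their limit does not
  depend on the representing sequences.
\<close>

locale matrix_pseudometric =
  fixes A :: "'a mspace"
  assumes madd_closed: "x \<in> carrier A \<Longrightarrow> y \<in> carrier A \<Longrightarrow> madd A x y \<in> carrier A"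
    and mscale_closed: "x \<in> carrier A \<Longrightarrow> mscale A c x \<in> carrier A"
    and mdist_self: "x \<in> carrier A \<Longrightarrow> mdist A x x = 0"
    and mdist_commute: "x \<in> carrier A \<Longrightarrow> y \<in> carrier A \<Longrightarrow> mdist A x y = mdist A y x"
    and mdist_triangle:
      "x \<in> carrier A \<Longrightarrow> y \<in> carrier A \<Longrightarrow> z \<in> carrier A \<Longrightarrow> mdist A x z \<le> mdist A x y + mdist A y z"
    and mdist_madd_le:
      "x \<in> carrier A \<Longrightarrow> y \<in> carrier A \<Longrightarrow> x' \<in> carrier A \<Longrightarrow> y' \<in> carrier A \<Longrightarrow>
        mdist A (madd A x y) (madd A x' y') \<le> mdist A x x' + mdist A y y'"
    and mdist_mscale_le:
      "x \<in> carrier A \<Longrightarrow> y \<in> carrier A \<Longrightarrow> mdist A (mscale A c x) (mscale A c y) \<le> cmod c * mdist A x y"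
    and mnorm_diff_le:
      "u \<in> mats n A \<Longrightarrow> v \<in> mats n A \<Longrightarrow>
        \<bar>mnorm A n u - mnorm A n v\<bar> \<le> (\<Sum>i<n. \<Sum>j<n. mdist A (u i j) (v i j))"
begin

lemma mdist_nonneg: "x \<in> carrier A \<Longrightarrow> y \<in> carrier A \<Longrightarrow> 0 \<le> mdist A x y"
  using mdist_triangle[of x y x] mdist_self[of x] mdist_commute[of y x] by simp

lemma mcauchy_carrier: "f \<in> mcauchy A \<Longrightarrow> f k \<in> carrier A"
  by (simp add: mcauchy_def)

text \<open>
  In this form, Cauchy sequences inherit stability under finite sums and majorants from limits of real
  functions.
\<close>

lemma mcauchy_iff_tendsto:
  "f \<in> mcauchy A \<longleftrightarrow> (\<forall>k. f k \<in> carrier A) \<and>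
    ((\<lambda>(k, l). mdist A (f k) (f l)) \<longlongrightarrow> 0) (sequentially \<times>\<^sub>F sequentially)"
proof -
  have "((\<lambda>(k, l). mdist A (f k) (f l)) \<longlongrightarrow> 0) (sequentially \<times>\<^sub>F sequentially) \<longleftrightarrow>
      (\<forall>e>0. \<exists>N. \<forall>m\<ge>N. \<forall>n\<ge>N. mdist A (f m) (f n) < e)" if f: "\<forall>k. f k \<in> carrier A"
  proof -
    have "dist (mdist A (f k) (f l)) 0 = mdist A (f k) (f l)" for k l
      using f mdist_nonneg by simp
    then show ?thesis
      unfolding tendsto_iff eventually_prod_sequentially by (simp add: case_prod_beta) blast
  qed
  then show ?thesis by (auto simp: mcauchy_def)
qed

lemma mcauchy_dominated:
  assumes f: "f \<in> mcauchy A" and g: "g \<in> mcauchy A" and h: "\<And>k. h k \<in> carrier A"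
    and le: "\<And>k l. mdist A (h k) (h l) \<le> c * mdist A (f k) (f l) + d * mdist A (g k) (g l)"
  shows "h \<in> mcauchy A"
proof -
  have "((\<lambda>(k, l). mdist A (f k) (f l)) \<longlongrightarrow> 0) (sequentially \<times>\<^sub>F sequentially)"
    and "((\<lambda>(k, l). mdist A (g k) (g l)) \<longlongrightarrow> 0) (sequentially \<times>\<^sub>F sequentially)"
    using f g by (simp_all add: mcauchy_iff_tendsto)
  then have "((\<lambda>(k, l). c * mdist A (f k) (f l) + d * mdist A (g k) (g l)) \<longlongrightarrow> c * 0 + d * 0)
      (sequentially \<times>\<^sub>F sequentially)"
    unfolding case_prod_beta by (intro tendsto_intros)
  then have "((\<lambda>(k, l). c * mdist A (f k) (f l) + d * mdist A (g k) (g l)) \<longlongrightarrow> 0)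
      (sequentially \<times>\<^sub>F sequentially)"
    by simp
  then have "((\<lambda>(k, l). mdist A (h k) (h l)) \<longlongrightarrow> 0) (sequentially \<times>\<^sub>F sequentially)"
    by (rule tendsto_null_dominated) (auto simp: mdist_nonneg[OF h h] intro: le)
  with h show ?thesis by (simp add: mcauchy_iff_tendsto)
qed

lemma mcauchy_madd:
  assumes "f \<in> mcauchy A" "g \<in> mcauchy A"
  shows "(\<lambda>k. madd A (f k) (g k)) \<in> mcauchy A"
  using assms
  by (intro mcauchy_dominated[where c = 1 and d = 1, OF assms])
    (simp_all add: mcauchy_carrier madd_closed mdist_madd_le)

lemma mcauchy_mscale:
  assumes "f \<in> mcauchy A"
  shows "(\<lambda>k. mscale A c (f k)) \<in> mcauchy A"
  using assms
  by (intro mcauchy_dominated[where c = "cmod c" and d = 0, OF assms assms])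
    (simp_all add: mcauchy_carrier mscale_closed mdist_mscale_le)

lemma mcauchy_const: "x \<in> carrier A \<Longrightarrow> (\<lambda>_. x) \<in> mcauchy A"
  by (simp add: mcauchy_def mdist_self)

lemma equiv_compl_rel: "equiv (mcauchy A) (compl_rel A)"
proof (rule equivI)
  show "compl_rel A \<subseteq> mcauchy A \<times> mcauchy A"
    by (auto simp: compl_rel_def)
  show "refl_on (mcauchy A) (compl_rel A)"
    by (auto simp: refl_on_def compl_rel_def mdist_self mcauchy_carrier)
  show "sym (compl_rel A)"
    by (rule symI) (auto simp: compl_rel_def mcauchy_carrier mdist_commute)
  show "trans (compl_rel A)"
  proof (rule transI)
    fix f g h assume fg: "(f, g) \<in> compl_rel A" and gh: "(g, h) \<in> compl_rel A"
    then have "(\<lambda>k. mdist A (f k) (g k) + mdist A (g k) (h k)) \<longlonglongrightarrow> 0"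
      by (intro tendsto_add_zero) (auto simp: compl_rel_def)
    then have "(\<lambda>k. mdist A (f k) (h k)) \<longlonglongrightarrow> 0"
      using fg gh
      by (elim tendsto_null_dominated) (auto simp: compl_rel_def mcauchy_carrier mdist_nonneg mdist_triangle)
    then show "(f, h) \<in> compl_rel A"
      using fg gh by (simp add: compl_rel_def)
  qed
qed

lemma compl_relI:
  assumes "f \<in> mcauchy A" "g \<in> mcauchy A" "s \<longlonglongrightarrow> 0" "\<And>k. mdist A (f k) (g k) \<le> s k"
  shows "(f, g) \<in> compl_rel A"
proof -
  have "(\<lambda>k. mdist A (f k) (g k)) \<longlonglongrightarrow> 0"
    using assms by (intro tendsto_null_dominated[OF assms(3)]) (auto simp: mcauchy_carrier mdist_nonneg)
  then show ?thesis using assms(1,2) by (simp add: compl_rel_def)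
qed

lemma completion_carrierE:
  assumes "X \<in> carrier (completion A)"
  obtains f where "f \<in> mcauchy A" "X = compl_rel A `` {f}"
proof -
  have "X \<in> mcauchy A // compl_rel A" using assms by (simp add: completion_def)
  then show thesis by (rule quotientE) (rule that)
qed

lemma completion_class_carrier: "f \<in> mcauchy A \<Longrightarrow> compl_rel A `` {f} \<in> carrier (completion A)"
  by (simp add: completion_def quotientI)

lemma completion_madd_class:
  assumes f: "f \<in> mcauchy A" and g: "g \<in> mcauchy A"
  shows "madd (completion A) (compl_rel A `` {f}) (compl_rel A `` {g})
    = compl_rel A `` {\<lambda>k. madd A (f k) (g k)}"
proof -
  have "congruent2 (compl_rel A) (compl_rel A) (\<lambda>f g. compl_rel A `` {\<lambda>k. madd A (f k) (g k)})"
  proof (rule congruent2I', rule equiv_class_eq[OF equiv_compl_rel])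
    fix f f' g g' assume *: "(f, f') \<in> compl_rel A" "(g, g') \<in> compl_rel A"
    then have "(\<lambda>k. mdist A (f k) (f' k) + mdist A (g k) (g' k)) \<longlonglongrightarrow> 0"
      by (intro tendsto_add_zero) (auto simp: compl_rel_def)
    then show "(\<lambda>k. madd A (f k) (g k), \<lambda>k. madd A (f' k) (g' k)) \<in> compl_rel A"
      using * by (intro compl_relI[where s = "\<lambda>k. mdist A (f k) (f' k) + mdist A (g k) (g' k)"])
        (auto simp: compl_rel_def mcauchy_madd mdist_madd_le mcauchy_carrier)
  qed
  from UN_equiv_class2[OF equiv_compl_rel equiv_compl_rel this f g] show ?thesis
    by (simp add: completion_def)
qed

lemma completion_mscale_class:
  assumes f: "f \<in> mcauchy A"
  shows "mscale (completion A) c (compl_rel A `` {f}) = compl_rel A `` {\<lambda>k. mscale A c (f k)}"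
proof -
  have "congruent (compl_rel A) (\<lambda>f. compl_rel A `` {\<lambda>k. mscale A c (f k)})"
  proof (rule congruentI, rule equiv_class_eq[OF equiv_compl_rel])
    fix f f' assume *: "(f, f') \<in> compl_rel A"
    then have "(\<lambda>k. mdist A (f k) (f' k)) \<longlonglongrightarrow> 0"
      by (simp add: compl_rel_def)
    from tendsto_mult_right_zero[OF this] show "(\<lambda>k. mscale A c (f k), \<lambda>k. mscale A c (f' k)) \<in> compl_rel A"
      using * by (intro compl_relI[where s = "\<lambda>k. cmod c * mdist A (f k) (f' k)"])
        (auto simp: compl_rel_def mcauchy_mscale mdist_mscale_le mcauchy_carrier)
  qed
  from UN_equiv_class[OF equiv_compl_rel this f] show ?thesis
    by (simp add: completion_def)
qed

text \<open>
  The matrix norms of the completion are computed with chosen representatives; these represent the right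
  classes.
\<close>

lemma completion_representative:
  assumes "X \<in> carrier (completion A)"
  shows "(SOME f. f \<in> X) \<in> mcauchy A" and "X = compl_rel A `` {SOME f. f \<in> X}"
proof -
  obtain f where f: "f \<in> mcauchy A" and X: "X = compl_rel A `` {f}"
    by (rule completion_carrierE[OF assms])
  have "f \<in> X" unfolding X by (rule equiv_class_self[OF equiv_compl_rel f])
  then have "(SOME f. f \<in> X) \<in> X" by (rule someI[where P = "\<lambda>f. f \<in> X"])
  then have rel: "(f, SOME f. f \<in> X) \<in> compl_rel A" using X by blast
  then show "(SOME f. f \<in> X) \<in> mcauchy A" by (simp add: compl_rel_def)
  show "X = compl_rel A `` {SOME f. f \<in> X}"
    by (rule trans[OF X equiv_class_eq[OF equiv_compl_rel rel]])
qed

lemma mnorm_null_difference: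
  assumes "\<And>i j. i < n \<Longrightarrow> j < n \<Longrightarrow> (F i j, G i j) \<in> compl_rel A"
  shows "(\<lambda>k. mnorm A n (\<lambda>i j. F i j k) - mnorm A n (\<lambda>i j. G i j k)) \<longlonglongrightarrow> 0"
proof (rule Lim_null_comparison)
  show "(\<lambda>k. \<Sum>i<n. \<Sum>j<n. mdist A (F i j k) (G i j k)) \<longlonglongrightarrow> 0"
    using assms by (intro tendsto_null_sum) (auto simp: compl_rel_def)
  have "(\<lambda>i j. F i j k) \<in> mats n A" "(\<lambda>i j. G i j k) \<in> mats n A" for k
    using assms by (auto simp: mats_def compl_rel_def mcauchy_carrier)
  then show "\<forall>\<^sub>F k in sequentially. norm (mnorm A n (\<lambda>i j. F i j k) - mnorm A n (\<lambda>i j. G i j k))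
      \<le> (\<Sum>i<n. \<Sum>j<n. mdist A (F i j k) (G i j k))"
    by (intro always_eventually allI) (simp add: mnorm_diff_le)
qed

lemma mnorm_convergent:
  assumes F: "\<And>i j. i < n \<Longrightarrow> j < n \<Longrightarrow> F i j \<in> mcauchy A"
  shows "convergent (\<lambda>k. mnorm A n (\<lambda>i j. F i j k))"
proof -
  let ?s = "\<lambda>(k, l). \<Sum>i<n. \<Sum>j<n. mdist A (F i j k) (F i j l)"
  have mats: "(\<lambda>i j. F i j k) \<in> mats n A" for k
    using F by (auto simp: mats_def mcauchy_carrier)
  have "((\<lambda>p. mdist A (F i j (fst p)) (F i j (snd p))) \<longlongrightarrow> 0) (sequentially \<times>\<^sub>F sequentially)"
    if "i < n" "j < n" for i j
    using F[OF that] unfolding mcauchy_iff_tendsto case_prod_beta by (rule conjunct2)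
  then have "(?s \<longlongrightarrow> 0) (sequentially \<times>\<^sub>F sequentially)"
    unfolding case_prod_beta by (intro tendsto_null_sum) simp_all
  then have "((\<lambda>(k, l). dist (mnorm A n (\<lambda>i j. F i j k)) (mnorm A n (\<lambda>i j. F i j l))) \<longlongrightarrow> 0)
      (sequentially \<times>\<^sub>F sequentially)"
    by (rule tendsto_null_dominated) (auto simp: dist_real_def intro!: mnorm_diff_le mats)
  then have "Cauchy (\<lambda>k. mnorm A n (\<lambda>i j. F i j k))"
    unfolding tendsto_iff eventually_prod_sequentially Cauchy_def
    by (simp add: case_prod_beta) blast
  then show ?thesis by (rule Cauchy_convergent)
qed

end

lemma complete_contractionI:
  assumes "clinear_between A B f"
    and "\<And>n x. 1 \<le> n \<Longrightarrow> x \<in> mats n A \<Longrightarrow> mnorm A n x \<le> 1 \<Longrightarrow> mnorm B n (\<lambda>i j. f (x i j)) \<le> 1"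
  shows "complete_contraction A B f"
  using assms unfolding complete_contraction_def cb_norm_def
  by (auto intro!: SUP_least simp: ennreal_le_1)

lemma complete_contractionD:
  assumes f: "complete_contraction A B f" and n: "1 \<le> n" and x: "x \<in> mats n A" "mnorm A n x \<le> 1"
  shows "mnorm B n (\<lambda>i j. f (x i j)) \<le> 1"
proof -
  have "ennreal (mnorm B n (\<lambda>i j. f (x i j))) \<le> cb_norm A B f"
    unfolding cb_norm_def using n x by (auto intro!: SUP_upper2[of n] SUP_upper2[of x])
  also have "\<dots> \<le> 1" using f by (simp add: complete_contraction_def)
  finally show ?thesis by (simp add: ennreal_le_1)
qed

text \<open>
  The extension applies \<open>T\<close> to the terms of a Cauchy sequence. The representatives that the norm of the
  target chooses differ from these images by null sequences, so the norm inequality passes to the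
  limit.
\<close>

lemma completion_extension:
  assumes "matrix_pseudometric A" and "matrix_pseudometric B"
    and T: "clinear_between A B T"
    and contr: "\<And>n u. 1 \<le> n \<Longrightarrow> u \<in> mats n A \<Longrightarrow> mnorm B n (\<lambda>i j. T (u i j)) \<le> mnorm A n u"
  shows "\<exists>\<Phi>. complete_contraction (completion A) (completion B) \<Phi> \<and>
    (\<forall>u\<in>carrier A. \<Phi> (compl_embed A u) = compl_embed B (T u))"
proof -
  interpret A: matrix_pseudometric A by fact
  interpret B: matrix_pseudometric B by fact
  have Tc: "T x \<in> carrier B" if "x \<in> carrier A" for x
    using T that by (auto simp: clinear_between_def)
  have Tadd: "T (madd A x y) = madd B (T x) (T y)" if "x \<in> carrier A" "y \<in> carrier A" for x y
    using T that by (auto simp: clinear_between_def)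
  have Tscale: "T (mscale A c x) = mscale B c (T x)" if "x \<in> carrier A" for c x
    using T that by (auto simp: clinear_between_def)
  have Tdist: "mdist B (T x) (T y) \<le> mdist A x y" if "x \<in> carrier A" "y \<in> carrier A" for x y
    using contr[of 1 "\<lambda>_ _. madd A x (mscale A (-1) y)"] that
    by (simp add: mdist_def mats_def Tadd Tscale A.madd_closed A.mscale_closed)
  have Tcauchy: "(\<lambda>k. T (f k)) \<in> mcauchy B" if "f \<in> mcauchy A" for f
  proof -
    have "\<exists>N. \<forall>m\<ge>N. \<forall>n\<ge>N. mdist B (T (f m)) (T (f n)) < e" if "e > 0" for e
    proof -
      obtain N where "\<forall>m\<ge>N. \<forall>n\<ge>N. mdist A (f m) (f n) < e"
        using \<open>f \<in> mcauchy A\<close> \<open>e > 0\<close> unfolding mcauchy_def by blast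
      then show ?thesis
        using Tdist A.mcauchy_carrier[OF \<open>f \<in> mcauchy A\<close>] by (meson le_less_trans)
    qed
    then show ?thesis
      using Tc A.mcauchy_carrier[OF that] by (simp add: mcauchy_def)
  qed
  have Trel: "(\<lambda>k. T (f k), \<lambda>k. T (g k)) \<in> compl_rel B" if "(f, g) \<in> compl_rel A" for f g
    using that
    by (intro B.compl_relI[where s = "\<lambda>k. mdist A (f k) (g k)"])
      (auto simp: compl_rel_def Tcauchy A.mcauchy_carrier intro: Tdist)
  define \<Phi> where "\<Phi> X = (\<Union>f\<in>X. compl_rel B `` {\<lambda>k. T (f k)})" for X
  have \<Phi>: "\<Phi> (compl_rel A `` {f}) = compl_rel B `` {\<lambda>k. T (f k)}" if "f \<in> mcauchy A" for f
    unfolding \<Phi>_def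
    by (rule UN_equiv_class[OF A.equiv_compl_rel _ that])
      (auto intro!: congruentI equiv_class_eq[OF B.equiv_compl_rel] Trel)
  have lin: "clinear_between (completion A) (completion B) \<Phi>"
    unfolding clinear_between_def
  proof (intro conjI ballI allI)
    show "\<Phi> ` carrier (completion A) \<subseteq> carrier (completion B)"
      by (auto elim!: A.completion_carrierE simp: \<Phi> intro!: B.completion_class_carrier Tcauchy)
    fix X assume "X \<in> carrier (completion A)"
    then obtain f where f: "f \<in> mcauchy A" "X = compl_rel A `` {f}"
      by (rule A.completion_carrierE)
    show "\<Phi> (mscale (completion A) c X) = mscale (completion B) c (\<Phi> X)" for c
      using f(1) unfolding f(2)
      by (simp add: \<Phi> A.completion_mscale_class A.mcauchy_mscale Tscale A.mcauchy_carrier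
          B.completion_mscale_class Tcauchy)
    fix Y assume "Y \<in> carrier (completion A)"
    then obtain g where g: "g \<in> mcauchy A" "Y = compl_rel A `` {g}"
      by (rule A.completion_carrierE)
    show "\<Phi> (madd (completion A) X Y) = madd (completion B) (\<Phi> X) (\<Phi> Y)"
      using f(1) g(1) unfolding f(2) g(2)
      by (simp add: \<Phi> A.completion_madd_class A.mcauchy_madd Tadd A.mcauchy_carrier
          B.completion_madd_class Tcauchy)
  qed
  have "complete_contraction (completion A) (completion B) \<Phi>"
  proof (rule complete_contractionI[OF lin])
    fix n X assume n: "1 \<le> n" and X: "X \<in> mats n (completion A)"
      and le1: "mnorm (completion A) n X \<le> 1"
    define F where "F i j = (SOME f. f \<in> X i j)" for i j
    define G where "G i j = (SOME g. g \<in> \<Phi> (X i j))" for i j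
    have Xc: "X i j \<in> carrier (completion A)" if "i < n" "j < n" for i j
      using X that by (simp add: mats_def)
    have F: "F i j \<in> mcauchy A" "X i j = compl_rel A `` {F i j}" if "i < n" "j < n" for i j
      unfolding F_def by (rule A.completion_representative[OF Xc[OF that]])+
    have \<Phi>X: "\<Phi> (X i j) = compl_rel B `` {\<lambda>k. T (F i j k)}" if "i < n" "j < n" for i j
      using \<Phi>[OF F(1)[OF that]] F(2)[OF that] by simp
    have rel: "((\<lambda>k. T (F i j k)), G i j) \<in> compl_rel B" if "i < n" "j < n" for i j
    proof -
      have "\<Phi> (X i j) \<in> carrier (completion B)"
        unfolding \<Phi>X[OF that] using F(1)[OF that] by (intro B.completion_class_carrier Tcauchy)
      from B.completion_representative[OF this]
      have "G i j \<in> mcauchy B" "\<Phi> (X i j) = compl_rel B `` {G i j}"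
        unfolding G_def .
      then have "G i j \<in> mcauchy B" "compl_rel B `` {\<lambda>k. T (F i j k)} = compl_rel B `` {G i j}"
        unfolding \<Phi>X[OF that] .
      then show ?thesis
        using eq_equiv_class[OF _ B.equiv_compl_rel] by blast
    qed
    have "convergent (\<lambda>k. mnorm A n (\<lambda>i j. F i j k))"
      by (rule A.mnorm_convergent) (rule F(1))
    then obtain a where a: "(\<lambda>k. mnorm A n (\<lambda>i j. F i j k)) \<longlonglongrightarrow> a"
      by (auto simp: convergent_def)
    then have "mnorm (completion A) n X = a"
      by (simp add: completion_def F_def[symmetric] limI)
    then have a1: "a \<le> 1" using le1 by simp
    have "convergent (\<lambda>k. mnorm B n (\<lambda>i j. G i j k))"
      by (rule B.mnorm_convergent) (use rel in \<open>auto simp: compl_rel_def\<close>)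
    then obtain b where b: "(\<lambda>k. mnorm B n (\<lambda>i j. G i j k)) \<longlonglongrightarrow> b"
      by (auto simp: convergent_def)
    then have beq: "mnorm (completion B) n (\<lambda>i j. \<Phi> (X i j)) = b"
      by (simp add: completion_def G_def[symmetric] limI)
    have "(\<lambda>k. mnorm B n (\<lambda>i j. T (F i j k)) - mnorm B n (\<lambda>i j. G i j k)) \<longlonglongrightarrow> 0"
      by (rule B.mnorm_null_difference[where F = "\<lambda>i j k. T (F i j k)", OF rel])
    from tendsto_add[OF this b] have "(\<lambda>k. mnorm B n (\<lambda>i j. T (F i j k))) \<longlonglongrightarrow> b"
      by simp
    moreover have "mnorm B n (\<lambda>i j. T (F i j k)) \<le> mnorm A n (\<lambda>i j. F i j k)" for k
      using F(1) by (intro contr n) (auto simp: mats_def A.mcauchy_carrier)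
    ultimately have "b \<le> a"
      by (intro LIMSEQ_le[OF _ a]) auto
    then show "mnorm (completion B) n (\<lambda>i j. \<Phi> (X i j)) \<le> 1"
      using a1 beq by simp
  qed
  moreover have "\<Phi> (compl_embed A u) = compl_embed B (T u)" if "u \<in> carrier A" for u
    unfolding compl_embed_def using \<Phi>[OF A.mcauchy_const[OF that]] .
  ultimately show ?thesis by blast
qed

section \<open>Functoriality of the Schur tensor product\<close>

context schur_pair
begin

lemma schur_alg_sel:
  "carrier (schur_alg A B) = tensor_carrier A B" "madd (schur_alg A B) = tensor_add A B"
  "mscale (schur_alg A B) = tensor_scale A B" "mnorm (schur_alg A B) = schur_norm A B"
  by (simp_all add: schur_alg_def)

lemma schur_alg_carrierE:
  assumes "x \<in> carrier (schur_alg A B)"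
  obtains f where "f \<in> free_pairs A B" "x = tensor_class A B f"
  using assms unfolding schur_alg_sel by (rule tensor_carrierE)

lemma tensor_diff_class:
  assumes "f \<in> free_pairs A B" "g \<in> free_pairs A B"
  shows "tensor_add A B (tensor_class A B f) (tensor_scale A B (-1) (tensor_class A B g))
    = tensor_class A B (f - g)"
  using assms
  by (simp add: tensor_scale_class tensor_add_class free_pairs_scale del: free.scale_minus_left)
    (simp add: free.scale_minus_left)

lemma mdist_schur_class:
  assumes "f \<in> free_pairs A B" "g \<in> free_pairs A B"
  shows "mdist (schur_alg A B) (tensor_class A B f) (tensor_class A B g)
    = schur_norm A B 1 (\<lambda>_ _. tensor_class A B (f - g))"
  by (simp add: mdist_def schur_alg_sel tensor_diff_class[OF assms])

lemma schur_class_add_le: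
  assumes "f \<in> free_pairs A B" "g \<in> free_pairs A B"
  shows "schur_norm A B 1 (\<lambda>_ _. tensor_class A B (f + g))
    \<le> schur_norm A B 1 (\<lambda>_ _. tensor_class A B f) + schur_norm A B 1 (\<lambda>_ _. tensor_class A B g)"
  using schur_norm_add_le[of "\<lambda>_ _. tensor_class A B f" 1 "\<lambda>_ _. tensor_class A B g"] assms
  by (simp add: mats_def schur_alg_sel tensor_class_carrier tensor_add_class)

lemma schur_class_scale_le:
  assumes "f \<in> free_pairs A B"
  shows "schur_norm A B 1 (\<lambda>_ _. tensor_class A B (free_scale c f))
    \<le> cmod c * schur_norm A B 1 (\<lambda>_ _. tensor_class A B f)"
  using schur_norm_scale_le[of "\<lambda>_ _. tensor_class A B f" 1 c] assms
  by (simp add: mats_def schur_alg_sel tensor_class_carrier tensor_scale_class)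

text \<open>
  By the triangle inequality for \<open>u = v + (u - v)\<close>, where the norm of \<open>u - v\<close> is bounded by the sum of the
  norms of its entries.
\<close>

lemma schur_norm_diff_le:
  assumes u: "u \<in> mats p (schur_alg A B)" and v: "v \<in> mats p (schur_alg A B)"
  shows "schur_norm A B p u - schur_norm A B p v
    \<le> (\<Sum>i<p. \<Sum>j<p. mdist (schur_alg A B) (u i j) (v i j))"
proof -
  let ?d = "\<lambda>i j. tensor_add A B (u i j) (tensor_scale A B (-1) (v i j))"
  have carr: "u i j \<in> tensor_carrier A B" "v i j \<in> tensor_carrier A B" if "i < p" "j < p" for i j
    using u v that by (simp_all add: mats_def schur_alg_sel)
  have d: "?d \<in> mats p (schur_alg A B)"
    using carr by (simp add: mats_def schur_alg_sel tensor_add_carrier tensor_scale_carrier)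
  have cancel: "tensor_add A B t (tensor_add A B s (tensor_scale A B (-1) t)) = s"
    if "s \<in> tensor_carrier A B" "t \<in> tensor_carrier A B" for s t
    using that
    by (auto elim!: tensor_carrierE simp: tensor_diff_class tensor_add_class free_pairs_diff)
  have "schur_norm A B p u = schur_norm A B p (\<lambda>i j. tensor_add A B (v i j) (?d i j))"
    unfolding schur_norm_def by (simp add: cancel carr)
  also have "\<dots> \<le> schur_norm A B p v + schur_norm A B p ?d"
    by (rule schur_norm_add_le[OF v d])
  also have "schur_norm A B p ?d \<le> (\<Sum>i<p. \<Sum>j<p. schur_norm A B 1 (\<lambda>_ _. ?d i j))"
    by (rule schur_norm_le_sum_entries[OF d])
  finally show ?thesis
    by (simp add: mdist_def schur_alg_sel)
qed

lemma schur_alg_matrix_pseudometric: "matrix_pseudometric (schur_alg A B)"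
proof -
  let ?S = "schur_alg A B"
  have self: "mdist ?S x x = 0" if x: "x \<in> carrier ?S" for x
  proof -
    obtain f where f: "f \<in> free_pairs A B" "x = tensor_class A B f"
      by (rule schur_alg_carrierE[OF x])
    have "schur_norm A B 1 (\<lambda>_ _. tensor_class A B 0) \<le> 0"
      using schur_norm_le[OF schur_decomp_zero] by (simp add: tensor_zero_def)
    moreover have "0 \<le> schur_norm A B 1 (\<lambda>_ _. tensor_class A B 0)"
      by (rule schur_norm_nonneg) (simp add: mats_def schur_alg_sel tensor_class_carrier free_pairs_zero)
    ultimately show ?thesis using f by (simp add: mdist_schur_class)
  qed
  have sym_le: "mdist ?S x y \<le> mdist ?S y x" if x: "x \<in> carrier ?S" and y: "y \<in> carrier ?S" for x y
  proof -
    obtain f where f: "f \<in> free_pairs A B" "x = tensor_class A B f"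
      by (rule schur_alg_carrierE[OF x])
    obtain g where g: "g \<in> free_pairs A B" "y = tensor_class A B g"
      by (rule schur_alg_carrierE[OF y])
    show ?thesis
      using schur_class_scale_le[OF free_pairs_diff[OF g(1) f(1)], of "-1"] f g
      by (simp add: mdist_schur_class)
  qed
  show ?thesis
  proof
    fix x y assume xy: "x \<in> carrier ?S" "y \<in> carrier ?S"
    obtain f where f: "f \<in> free_pairs A B" "x = tensor_class A B f"
      by (rule schur_alg_carrierE[OF xy(1)])
    obtain g where g: "g \<in> free_pairs A B" "y = tensor_class A B g"
      by (rule schur_alg_carrierE[OF xy(2)])
    show "madd ?S x y \<in> carrier ?S"
      using xy by (simp add: schur_alg_sel tensor_add_carrier)
    show "mdist ?S x y = mdist ?S y x"
      using xy by (intro antisym sym_le)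
    show "mdist ?S (mscale ?S c x) (mscale ?S c y) \<le> cmod c * mdist ?S x y" for c
      using schur_class_scale_le[OF free_pairs_diff[OF f(1) g(1)], of c] f g
      by (simp add: mdist_schur_class schur_alg_sel tensor_scale_class free_pairs_scale
          free.scale_right_diff_distrib)
    fix z assume z: "z \<in> carrier ?S"
    obtain h where h: "h \<in> free_pairs A B" "z = tensor_class A B h"
      by (rule schur_alg_carrierE[OF z])
    show "mdist ?S x z \<le> mdist ?S x y + mdist ?S y z"
      using schur_class_add_le[OF free_pairs_diff[OF f(1) g(1)] free_pairs_diff[OF g(1) h(1)]] f g h
      by (simp add: mdist_schur_class)
    fix w assume w: "w \<in> carrier ?S"
    obtain k where k: "k \<in> free_pairs A B" "w = tensor_class A B k"
      by (rule schur_alg_carrierE[OF w])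
    show "mdist ?S (madd ?S x y) (madd ?S z w) \<le> mdist ?S x z + mdist ?S y w"
      using schur_class_add_le[OF free_pairs_diff[OF f(1) h(1)] free_pairs_diff[OF g(1) k(1)]] f g h k
      by (simp add: mdist_schur_class schur_alg_sel(2) tensor_add_class free_pairs_add add_diff_add)
  next
    show "mscale ?S c x \<in> carrier ?S" if "x \<in> carrier ?S" for c x
      using that by (simp add: schur_alg_sel tensor_scale_carrier)
    show "mdist ?S x x = 0" if "x \<in> carrier ?S" for x
      by (rule self[OF that])
    fix u v n assume u: "u \<in> mats n ?S" and v: "v \<in> mats n ?S"
    have "(\<Sum>i<n. \<Sum>j<n. mdist ?S (v i j) (u i j)) = (\<Sum>i<n. \<Sum>j<n. mdist ?S (u i j) (v i j))"
      using u v by (intro sum.cong refl antisym sym_le) (auto simp: mats_def)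
    then show "\<bar>mnorm ?S n u - mnorm ?S n v\<bar> \<le> (\<Sum>i<n. \<Sum>j<n. mdist ?S (u i j) (v i j))"
      using schur_norm_diff_le[OF u v] schur_norm_diff_le[OF v u] by (simp add: schur_alg_sel abs_le_iff)
  qed
qed

end

lemma schur_norm_tensor_map_le:
  assumes "matricial_space A" "matricial_space B" "matricial_space C" "matricial_space D"
    and \<phi>: "complete_contraction A C \<phi>" and \<psi>: "complete_contraction B D \<psi>"
    and u: "u \<in> mats p (schur_alg A B)"
  shows "schur_norm C D p (\<lambda>i j. tensor_map C D \<phi> \<psi> (u i j)) \<le> schur_norm A B p u"
proof (rule dense_ge)
  interpret AB: schur_pair A B by (rule schur_pair.intro) fact+
  interpret CD: schur_pair C D by (rule schur_pair.intro) fact+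
  fix M assume "schur_norm A B p u < M"
  then have "schur_decomp A B p u M"
    by (rule AB.schur_decomp_of_norm_less[OF u])
  then have "schur_decomp C D p (\<lambda>i j. tensor_map C D \<phi> \<psi> (u i j)) M"
    using \<phi> \<psi>
    by (intro schur_decomp_tensor_map)
      (auto simp: complete_contraction_def intro: complete_contractionD[OF \<phi>] complete_contractionD[OF \<psi>])
  then show "schur_norm C D p (\<lambda>i j. tensor_map C D \<phi> \<psi> (u i j)) \<le> M"
    by (rule CD.schur_norm_le)
qed

theorem corollary2p5:
  fixes V :: "('h::chilbert_space \<Rightarrow>\<^sub>L 'h) set"
    and V\<^sub>1 :: "('h1::chilbert_space \<Rightarrow>\<^sub>L 'h1) set"
    and W :: "('k::chilbert_space \<Rightarrow>\<^sub>L 'k) set"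
    and W\<^sub>1 :: "('k1::chilbert_space \<Rightarrow>\<^sub>L 'k1) set"
    and \<phi> :: "('h \<Rightarrow>\<^sub>L 'h) \<Rightarrow> ('h1 \<Rightarrow>\<^sub>L 'h1)"
    and \<psi> :: "('k \<Rightarrow>\<^sub>L 'k) \<Rightarrow> ('k1 \<Rightarrow>\<^sub>L 'k1)"
  assumes "operator_space V" and "operator_space V\<^sub>1"
    and "operator_space W" and "operator_space W\<^sub>1"
    and "complete_contraction (op_mspace V) (op_mspace V\<^sub>1) \<phi>"
    and "complete_contraction (op_mspace W) (op_mspace W\<^sub>1) \<psi>"
  shows "\<exists>\<Phi>. complete_contraction
               (schur_tensor (op_mspace V) (op_mspace W))
               (schur_tensor (op_mspace V\<^sub>1) (op_mspace W\<^sub>1)) \<Phi> \<and>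
             (\<forall>u \<in> carrier (schur_alg (op_mspace V) (op_mspace W)).
               \<Phi> (compl_embed (schur_alg (op_mspace V) (op_mspace W)) u) =
               compl_embed (schur_alg (op_mspace V\<^sub>1) (op_mspace W\<^sub>1))
                 (tensor_map (op_mspace V\<^sub>1) (op_mspace W\<^sub>1) \<phi> \<psi> u))"
proof -
  note spaces = op_mspace_matricial[OF assms(1)] op_mspace_matricial[OF assms(3)]
    op_mspace_matricial[OF assms(2)] op_mspace_matricial[OF assms(4)]
  interpret VW: schur_pair "op_mspace V" "op_mspace W"
    by (rule schur_pair.intro[OF spaces(1,2)])
  interpret VW\<^sub>1: schur_pair "op_mspace V\<^sub>1" "op_mspace W\<^sub>1"
    by (rule schur_pair.intro[OF spaces(3,4)])
  show ?thesis
    unfolding schur_tensor_def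
  proof (rule completion_extension)
    show "clinear_between (schur_alg (op_mspace V) (op_mspace W))
        (schur_alg (op_mspace V\<^sub>1) (op_mspace W\<^sub>1)) (tensor_map (op_mspace V\<^sub>1) (op_mspace W\<^sub>1) \<phi> \<psi>)"
      using assms(5,6) by (intro clinear_between_tensor_map) (simp_all add: complete_contraction_def)
    show "mnorm (schur_alg (op_mspace V\<^sub>1) (op_mspace W\<^sub>1)) n
          (\<lambda>i j. tensor_map (op_mspace V\<^sub>1) (op_mspace W\<^sub>1) \<phi> \<psi> (u i j))
        \<le> mnorm (schur_alg (op_mspace V) (op_mspace W)) n u"
      if "u \<in> mats n (schur_alg (op_mspace V) (op_mspace W))" for n u
      unfolding VW.schur_alg_sel VW\<^sub>1.schur_alg_sel
      by (rule schur_norm_tensor_map_le[OF spaces assms(5,6) that])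
  qed (rule VW.schur_alg_matrix_pseudometric VW\<^sub>1.schur_alg_matrix_pseudometric)+
qed

end
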